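(* Let $k\ge 3$ be an odd integer, $r$ a positive integer, and $q$ a prime power with $q\equiv 2k+1 \pmod{4k}$ and $q>8k^5\lceil r/k\rceil$. Then there exists a $\left(\frac{q-1}{2},k;r\right)$-MOHS.
   Context: Let $G$ be an abelian group of odd order $2v+1\ge 7$. A half-set of $G$ is a subset $V\subseteq G\setminus\{0\}$ containing exactly one element of each pair $\{g,-g\}$, $g\ne 0$. A $(v,k)$ Heffter system on $V$ is a partition of $V$ into blocks of size $k$, each summing to $0$ in $G$. Two Heffter systems on the same half-set are orthogonal if every block of one meets every block of the other in at most one element. A $(v,k;r)$-MOHS is a set of $r$ pairwise orthogonal $(v,k)$ Heffter systems on a common half-set of some abelian group of order $2v+1$. *)

theory Defs
  imports "HOL-Algebra.FiniteProduct" "HOL-Library.Disjoint_Sets" "HOL-Number_Theory.Number_Theory"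
begin

text \<open>Groups are HOL-Algebra structures written multiplicatively: the paper's
  0 is the unit, -g is the inverse, and a block sum is the finite product.\<close>

definition half_set :: "('a, 'b) monoid_scheme \<Rightarrow> 'a set \<Rightarrow> bool" where
  "half_set G V \<longleftrightarrow> V \<subseteq> carrier G - {\<one>\<^bsub>G\<^esub>} \<and>
     (\<forall>g \<in> carrier G - {\<one>\<^bsub>G\<^esub>}. (g \<in> V) \<noteq> (inv\<^bsub>G\<^esub> g \<in> V))"

definition heffter_system :: "('a, 'b) monoid_scheme \<Rightarrow> nat \<Rightarrow> nat \<Rightarrow> 'a set \<Rightarrow> 'a set set \<Rightarrow> bool" where
  "heffter_system G v k V P \<longleftrightarrow> card V = v \<and> partition_on V P \<and>
     (\<forall>B \<in> P. card B = k \<and> finprod G (\<lambda>x. x) B = \<one>\<^bsub>G\<^esub>)"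

definition orthogonal_systems :: "'a set set \<Rightarrow> 'a set set \<Rightarrow> bool" where
  "orthogonal_systems P Q \<longleftrightarrow> (\<forall>B \<in> P. \<forall>C \<in> Q. card (B \<inter> C) \<le> 1)"

text \<open>A (v,k;r)-MOHS: some abelian group of order 2v+1 (taken up to isomorphism,
  represented with carrier a set of naturals), a half-set V, and r pairwise
  orthogonal (v,k) Heffter systems on V.\<close>

definition MOHS :: "nat \<Rightarrow> nat \<Rightarrow> nat \<Rightarrow> bool" where
  "MOHS v k r \<longleftrightarrow> (\<exists>(G :: nat monoid) V (H :: nat \<Rightarrow> nat set set).
     comm_group G \<and> card (carrier G) = 2 * v + 1 \<and> 2 * v + 1 \<ge> 7 \<and>
     half_set G V \<and>
     (\<forall>i < r. heffter_system G v k V (H i)) \<and>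
     (\<forall>i < r. \<forall>j < r. i \<noteq> j \<longrightarrow> orthogonal_systems (H i) (H j)))"

end

theory Submission
  imports "HOL-Algebra.Algebraic_Closure" "HOL-Algebra.Weak_Morphisms" Defs
begin

text \<open>
  In the field of order \<open>q = 2 k t + 1\<close> with \<open>k\<close> and \<open>t\<close> odd, \<open>-1\<close> is not a square, so the nonzero
  squares form a half-set \<open>V\<close>. Let \<open>H\<close> be the subgroup of index \<open>k\<close> in \<open>V\<close>. If a zero-sum
  \<open>k\<close>-subset \<open>B\<close> of \<open>V\<close> is a transversal of \<open>V/H\<close>, then the sets \<open>u B\<close> with \<open>u\<close> in a fixed coset
  of \<open>H\<close> form a Heffter system, and the \<open>k\<close> cosets give \<open>k\<close> systems. Systems obtained from
  several such blocks are pairwise orthogonal as soon as all ratios of two distinct elements of a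
  block are distinct, within and between blocks; so \<open>\<lceil>r/k\<rceil>\<close> blocks suffice.

  The blocks are chosen greedily, except for the last two elements \<open>x\<close> and \<open>y\<close>, which have a
  prescribed nonzero sum and lie in prescribed cosets. A second-moment count of incidences between
  points and lines bounds from below the number of such pairs by about \<open>q/(4 k\<^sup>2) - sqrt q\<close>,
  and this exceeds the number of pairs which repeat a ratio.
\<close>

subsection \<open>Finite fields of prime power order\<close>

text \<open>Every block element has a prescribed coset. If only the last element were left to the
  zero-sum condition, its coset could not be controlled; two open elements with a known sum leave a
  set that can be counted. Its size is a cyclotomic number, and the second moment gives an error of
  order sqrt q by elementary counting, without character sums.

  What has to be beaten is the number of repeated ratios. A ratio of elements from classes i and j
  lies in class i - j, so a block has at most k ratios in any one class, and a new element, compared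
  with one earlier element, meets the forbidden ratios of a single class only. With n blocks the
  main term of the excluded pairs is therefore about 2 n k^2 instead of 2 n k^3. Against q / (4 k^2)
  available pairs this alone would ask for q > 8 n k^4; the further factor k in the assumption pays
  for sqrt q and the smaller terms.\<close>

lemma (in cring) binomial_theorem:
  assumes x: "x \<in> carrier R" and y: "y \<in> carrier R"
  shows "(x \<oplus> y) [^] (n::nat) = (\<Oplus>i\<in>{..n}. [(n choose i)] \<cdot> (x [^] i \<otimes> y [^] (n - i)))"
proof (induction n)
  case 0
  show ?case by (simp add: x y)
next
  case (Suc n)
  let ?f = "\<lambda>i. x [^] i \<otimes> y [^] (Suc n - i)"
  have cl: "\<And>i m. x [^] (i::nat) \<otimes> y [^] (m::nat) \<in> carrier R" using x y by simp
  have A: "(\<Oplus>i\<in>{..n}. [(n choose i)] \<cdot> (x [^] i \<otimes> y [^] (n - i))) \<otimes> x =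
      (\<Oplus>i\<in>{..n}. [(n choose i)] \<cdot> ?f (Suc i))"
    using x y by (subst finsum_ldistr) (auto intro!: finsum_cong' simp: add_pow_ldistr add_pow_rdistr m_ac)
  have B: "(\<Oplus>i\<in>{..n}. [(n choose i)] \<cdot> (x [^] i \<otimes> y [^] (n - i))) \<otimes> y =
      (\<Oplus>i\<in>{..n}. [(n choose i)] \<cdot> ?f i)"
    using x y by (subst finsum_ldistr)
      (auto intro!: finsum_cong' simp: add_pow_ldistr m_assoc Suc_diff_le)
  have B': "(\<Oplus>i\<in>{..n}. [(n choose i)] \<cdot> ?f i) = (\<Oplus>i\<in>{..Suc n}. [(n choose i)] \<cdot> ?f i)"
    using x y by (simp add: binomial_eq_0)
  have A': "(\<Oplus>i\<in>{..n}. [(n choose i)] \<cdot> ?f (Suc i)) =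
      (\<Oplus>i\<in>{..Suc n}. [(if i = 0 then 0 else (n choose (i - 1)))] \<cdot> ?f i)"
    using x y by (simp add: finsum_Suc2 del: finsum_Suc)
  have "(x \<oplus> y) [^] Suc n = (x \<oplus> y) [^] n \<otimes> x \<oplus> (x \<oplus> y) [^] n \<otimes> y"
    using x y by (simp add: r_distr)
  also have "\<dots> = (\<Oplus>i\<in>{..Suc n}. [(if i = 0 then 0 else (n choose (i - 1)))] \<cdot> ?f i)
      \<oplus> (\<Oplus>i\<in>{..Suc n}. [(n choose i)] \<cdot> ?f i)"
    unfolding Suc A B A' B' ..
  also have "\<dots> = (\<Oplus>i\<in>{..Suc n}. [(if i = 0 then 0 else (n choose (i - 1)))] \<cdot> ?f i \<oplus> [(n choose i)] \<cdot> ?f i)"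
    using cl by (subst finsum_addf) auto
  also have "\<dots> = (\<Oplus>i\<in>{..Suc n}. [(Suc n choose i)] \<cdot> ?f i)"
  proof (intro finsum_cong')
    fix i
    have "(if i = 0 then 0 else (n choose (i - 1))) + (n choose i) = (Suc n choose i)"
      by (cases i) auto
    then show "[(if i = 0 then 0 else (n choose (i - 1)))] \<cdot> ?f i \<oplus> [(n choose i)] \<cdot> ?f i
        = [(Suc n choose i)] \<cdot> ?f i"
      using add.nat_pow_mult[OF cl] by metis
  qed (use cl in auto)
  finally show ?case .
qed

text \<open>Proved for commutative rings because it is applied both in a field and in its polynomial
  ring.\<close>

lemma (in cring) frobenius_add:
  assumes p: "prime (p::nat)" and char: "[p] \<cdot> \<one> = \<zero>"
    and x: "x \<in> carrier R" and y: "y \<in> carrier R"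
  shows "(x \<oplus> y) [^] (p ^ n) = x [^] (p ^ n) \<oplus> y [^] (p ^ n)"
proof (induction n)
  case 0
  show ?case using x y by (simp add: nat_pow_eone)
next
  case (Suc n)
  have step: "(u \<oplus> v) [^] p = u [^] p \<oplus> v [^] p" if u: "u \<in> carrier R" and v: "v \<in> carrier R" for u v
  proof -
    obtain m where m: "p = Suc m" using p prime_gt_0_nat gr0_implies_Suc by blast
    obtain l where l: "m = Suc l" using p prime_gt_1_nat[OF p] m by (cases m) auto
    let ?f = "\<lambda>i. [(p choose i)] \<cdot> (u [^] i \<otimes> v [^] (p - i))"
    have cl: "u [^] i \<otimes> v [^] j \<in> carrier R" for i j :: nat using u v by simp
    have mult0: "[(p * c)] \<cdot> z = \<zero>" if z: "z \<in> carrier R" for z c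
    proof -
      have "[p] \<cdot> z = ([p] \<cdot> \<one>) \<otimes> z" using z by (simp add: add_pow_ldistr)
      then have "[p] \<cdot> z = \<zero>" using z char by simp
      then show ?thesis using add.nat_pow_pow[OF z, of c p] by (simp add: mult.commute)
    qed
    have mid: "?f i = \<zero>" if "0 < i" "i < p" for i
    proof -
      have "p dvd (p choose i)" using p that by (intro dvd_choose_prime) auto
      then obtain c where "(p choose i) = p * c" by (elim dvdE)
      then show ?thesis using mult0[OF cl] by simp
    qed
    have "(u \<oplus> v) [^] p = (\<Oplus>i\<in>{..p}. ?f i)" using binomial_theorem[OF u v] .
    also have "\<dots> = (\<Oplus>i\<in>{0, p}. ?f i)"
      using mid cl p prime_gt_0_nat[OF p] by (intro add.finprod_mono_neutral_cong_right) auto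
    also have "\<dots> = u [^] p \<oplus> v [^] p"
      using u v prime_gt_0_nat[OF p] by (simp add: a_comm)
    finally show ?thesis .
  qed
  have "(x \<oplus> y) [^] (p ^ Suc n) = ((x \<oplus> y) [^] (p ^ n)) [^] p"
    using x y by (simp add: nat_pow_pow mult.commute)
  also have "\<dots> = x [^] (p ^ Suc n) \<oplus> y [^] (p ^ Suc n)"
    using x y Suc step by (simp add: nat_pow_pow mult.commute)
  finally show ?case .
qed


lemma (in field) frobenius_fixed_subfield:
  assumes p: "prime (p::nat)" and char: "[p] \<cdot> \<one> = \<zero>"
  shows "subfield {x \<in> carrier R. x [^] (p ^ n) = x} R"
proof (rule subfieldI')
  let ?K = "{x \<in> carrier R. x [^] (p ^ n) = x}"
  have q0: "p ^ n > 0" using p prime_gt_0_nat by simp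
  \<comment> \<open>Additivity applied to \<open>x \<oplus> \<ominus> x\<close> gives the sign
    without a case distinction on the parity of p.\<close>
  have neg: "(\<ominus> x) [^] (p ^ n) = \<ominus> x" if x: "x \<in> ?K" for x
  proof -
    have "(x \<oplus> \<ominus> x) [^] (p ^ n) = x [^] (p ^ n) \<oplus> (\<ominus> x) [^] (p ^ n)"
      using x by (intro frobenius_add[OF p char]) auto
    moreover have "(x \<oplus> \<ominus> x) [^] (p ^ n) = \<zero>"
      using x q0 by (simp add: r_neg nat_pow_zero)
    ultimately have "x \<oplus> (\<ominus> x) [^] (p ^ n) = \<zero>" using x by simp
    then show ?thesis using x minus_equality[of "(\<ominus> x) [^] (p ^ n)" x] by (simp add: a_comm)
  qed
  show "subring ?K R"
  proof (rule ring.subringI[OF ring_axioms])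
    show "\<And>h1 h2. h1 \<in> ?K \<Longrightarrow> h2 \<in> ?K \<Longrightarrow> h1 \<oplus> h2 \<in> ?K"
      by (auto simp: frobenius_add[OF p char])
    show "\<And>h. h \<in> ?K \<Longrightarrow> \<ominus> h \<in> ?K" using neg by auto
  qed (auto simp: nat_pow_distrib)
  show "inv k \<in> ?K" if k: "k \<in> ?K - {\<zero>}" for k
  proof -
    have u: "k \<in> Units R" using k field_Units by auto
    have "(k \<otimes> inv k) [^] (p ^ n) = k [^] (p ^ n) \<otimes> (inv k) [^] (p ^ n)"
      using k u by (intro nat_pow_distrib) auto
    then have "k \<otimes> (inv k) [^] (p ^ n) = \<one>" using k u by (simp add: Units_r_inv)
    then have "inv k = (inv k) [^] (p ^ n)" using k u by (intro comm_inv_char) auto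
    then show ?thesis using u by simp
  qed
qed

text \<open>The fixed points are the roots of \<open>P\<close>, that is X^q - X. Over an
  algebraically closed field it has q roots counted with multiplicity, so it remains to see that
  every root is simple.\<close>

lemma (in algebraically_closed) card_frobenius_fixed:
  assumes p: "prime (p::nat)" and char: "[p] \<cdot> \<one> = \<zero>" and n: "n \<ge> 1"
  shows "finite {x \<in> carrier L. x [^] (p ^ n) = x}" "card {x \<in> carrier L. x [^] (p ^ n) = x} = p ^ n"
proof -
  define q where "q = p ^ n"
  have q1: "q > 1" unfolding q_def using one_less_power[OF prime_gt_1_nat[OF p], of n] n by simp
  interpret UP: domain "poly_ring L"
    using univ_poly_is_domain[OF carrier_is_subring] .
  let ?U = "poly_ring L"
  have X: "X \<in> carrier ?U" using var_closed(1)[OF carrier_is_subring] .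
  have Y: "\<ominus>\<^bsub>?U\<^esub> X = [\<ominus> \<one>, \<zero>]"
    using univ_poly_a_inv_def'[OF carrier_is_subring X] by (simp add: var_def)
  define P where "P = X [^]\<^bsub>?U\<^esub> q \<ominus>\<^bsub>?U\<^esub> X"
  have P: "P \<in> carrier ?U" unfolding P_def using X by simp
  have degP: "degree P = q"
  proof -
    have "polynomial (carrier L) (monom \<one> q)" 
      by (intro monom_is_polynomial carrier_is_subring) auto
    moreover have "polynomial (carrier L) [\<ominus> \<one>, \<zero>]"
      using Y X UP.a_inv_closed[OF X] by (simp add: univ_poly_carrier)
    moreover have "P = poly_add (monom \<one> q) [\<ominus> \<one>, \<zero>]"
      unfolding P_def a_minus_def Y unitary_monom_eq_var_pow[OF carrier_is_subring, symmetric]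
      by (simp add: univ_poly_add)
    moreover have "degree (monom \<one> q) = q" by (simp add: monom_def)
    ultimately show ?thesis 
      using q1 poly_add_degree_eq[OF carrier_is_subring, of "monom \<one> q" "[\<ominus> \<one>, \<zero>]"] by auto
  qed
  have P0: "P \<noteq> []" using degP q1 by auto
  have evP: "eval P a = a [^] q \<ominus> a" if a: "a \<in> carrier L" for a
  proof -
    interpret ev: ring_hom_ring ?U L "\<lambda>f. eval f a"
      using eval_ring_hom[OF carrier_is_subring a] by simp
    show ?thesis unfolding P_def using X a eval_var[OF a]
      by (simp add: a_minus_def ev.hom_nat_pow)
  qed
  have root: "is_root P a \<longleftrightarrow> a \<in> {x \<in> carrier L. x [^] q = x}" for a
    unfolding is_root_def using evP P0 by auto
  \<comment> \<open>With \<open>T = X - a\<close> the Frobenius map gives \<open>P = T^q - T\<close>, which is not divisible by \<open>T\<^sup>2\<close>.\<close>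
  have simple: "alg_mult P a = 1" if r: "is_root P a" for a
  proof -
    have a: "a \<in> carrier L" and aq: "a [^] q = a" using r root by auto
    interpret ev: ring_hom_ring ?U L "\<lambda>f. eval f a"
      using eval_ring_hom[OF carrier_is_subring a] by simp
    interpret pc: ring_hom_ring L ?U poly_of_const
      using canonical_embedding_ring_hom[OF carrier_is_subring] by simp
    let ?T = "[\<one>, \<ominus> a]"
    have T: "?T \<in> carrier ?U"
      using a unfolding univ_poly_carrier[symmetric] polynomial_def by auto
    define c where "c = poly_of_const a"
    have c: "c \<in> carrier ?U" unfolding c_def using a by auto
    have XT: "X = ?T \<oplus>\<^bsub>?U\<^esub> c"
      using a unfolding c_def poly_of_const_def by (auto simp: univ_poly_add var_def l_neg)
    have charU: "[p] \<cdot>\<^bsub>?U\<^esub> \<one>\<^bsub>?U\<^esub> = \<zero>\<^bsub>?U\<^esub>"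
    proof -
      have "poly_of_const ([m] \<cdot> \<one>) = [m] \<cdot>\<^bsub>?U\<^esub> \<one>\<^bsub>?U\<^esub>" for m :: nat
        by (induction m) (auto simp: pc.hom_add)
      then show ?thesis using char pc.hom_zero by metis
    qed
    have cq: "c [^]\<^bsub>?U\<^esub> q = c" unfolding c_def using aq a pc.hom_nat_pow by metis
    have "X [^]\<^bsub>?U\<^esub> q = ?T [^]\<^bsub>?U\<^esub> q \<oplus>\<^bsub>?U\<^esub> c"
      unfolding XT using UP.frobenius_add[OF p charU T c, of n] cq by (simp add: q_def)
    then have PT: "P = ?T [^]\<^bsub>?U\<^esub> q \<ominus>\<^bsub>?U\<^esub> ?T"
      unfolding P_def using T c XT UP.nat_pow_closed[OF T, of q] by algebra
    have ngt: "\<not> 2 \<le> alg_mult P a"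
    proof
      assume "2 \<le> alg_mult P a"
      then have "(?T [^]\<^bsub>?U\<^esub> (2::nat)) pdivides P" by (rule le_alg_mult_imp_pdivides[OF a P])
      then obtain r where rU: "r \<in> carrier ?U" and r: "P = (?T [^]\<^bsub>?U\<^esub> (2::nat)) \<otimes>\<^bsub>?U\<^esub> r"
        unfolding pdivides_def factor_def by auto
      obtain m where m: "q = Suc (Suc m)" using q1 less_natE by (metis add_2_eq_Suc le_Suc_ex Suc_leI One_nat_def numeral_2_eq_2)
      let ?W = "?T [^]\<^bsub>?U\<^esub> m"
      have W: "?W \<in> carrier ?U" using T by simp
      \<comment> \<open>From T^q - T = T^2 r one factor T is cancelled; evaluation at
        \<open>a\<close>, where T vanishes, then leaves -1 = 0.\<close>
      have "?T \<otimes>\<^bsub>?U\<^esub> (?T \<otimes>\<^bsub>?U\<^esub> ?W \<ominus>\<^bsub>?U\<^esub> \<one>\<^bsub>?U\<^esub>) = ?T \<otimes>\<^bsub>?U\<^esub> (?T \<otimes>\<^bsub>?U\<^esub> r)"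
        using PT r T W rU unfolding m by (simp add: numeral_2_eq_2, algebra)
      then have eq: "?T \<otimes>\<^bsub>?U\<^esub> ?W \<ominus>\<^bsub>?U\<^esub> \<one>\<^bsub>?U\<^esub> = ?T \<otimes>\<^bsub>?U\<^esub> r"
        using UP.m_lcancel[of ?T] T W rU by (simp add: univ_poly_zero)
      have "eval ?T a = \<zero>" using a by (simp add: r_neg)
      then have "eval (?T \<otimes>\<^bsub>?U\<^esub> r) a = \<zero>"
        "eval (?T \<otimes>\<^bsub>?U\<^esub> ?W \<ominus>\<^bsub>?U\<^esub> \<one>\<^bsub>?U\<^esub>) a = \<ominus> \<one>"
        using T W rU by (simp_all add: a_minus_def del: eval.simps)
      then have "\<ominus> \<one> = \<zero>" using eq by simp
      then show False using one_not_zero by (metis add.inv_eq_1_iff one_closed)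
    qed
    have "alg_mult P a > 0" using alg_mult_gt_zero_iff_is_root[OF P] r by simp
    then show ?thesis using ngt by simp
  qed
  have set: "set_mset (roots P) = {x \<in> carrier L. x [^] q = x}"
    using roots_mem_iff_is_root[OF P] root by blast
  have "q = size (roots P)" using roots_over_carrier[OF P] degP by (simp add: splitted_def)
  also have "\<dots> = (\<Sum>a\<in>set_mset (roots P). count (roots P) a)"
    by (simp add: size_multiset_overloaded_eq)
  also have "\<dots> = (\<Sum>a\<in>set_mset (roots P). 1)"
    using simple roots_mem_iff_is_root[OF P] alg_mult_eq_count_roots[OF P] by (intro sum.cong) auto
  also have "\<dots> = card {x \<in> carrier L. x [^] q = x}" using set by simp
  finally show "card {x \<in> carrier L. x [^] (p ^ n) = x} = p ^ n" by (simp add: q_def)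
  show "finite {x \<in> carrier L. x [^] (p ^ n) = x}"
    using set finite_set_mset[of "roots P"] by (simp add: q_def)
qed

text \<open>The field is cut out of an algebraic closure of the integers modulo p as the fixed field
  of x -> x^(p^n). The element type is the one on which the closure of a residue ring is
  built.\<close>

lemma exists_finite_field:
  assumes p: "prime (p::nat)" and n: "n \<ge> 1"
  obtains F :: "((int list \<times> nat) multiset \<Rightarrow> int) ring"
  where "field F" "finite (carrier F)" "card (carrier F) = p ^ n"
proof -
  define Z where "Z = residue_ring (int p)"
  interpret Z: residues_prime p Z by unfold_locales (use p Z_def in auto)
  obtain L :: "((int list \<times> nat) multiset \<Rightarrow> int) ring" where alg: "algebraic_closure L (Z.indexed_const ` (carrier Z))"
    and hom: "Z.indexed_const \<in> ring_hom Z L" using Z.exists_closure .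
  interpret L: algebraic_closure L "Z.indexed_const ` (carrier Z)" by (rule alg)
  interpret h: ring_hom_ring Z L Z.indexed_const
    using hom by (intro ring_hom_ringI2 Z.ring_axioms L.ring_axioms)
  have Zm: "[m] \<cdot>\<^bsub>Z\<^esub> \<one>\<^bsub>Z\<^esub> = int m mod int p" for m :: nat
    by (induction m) (auto simp: Z.res_zero_eq Z.res_one_eq Z.res_add_eq mod_simps add.commute)
  have Lm: "Z.indexed_const ([m] \<cdot>\<^bsub>Z\<^esub> \<one>\<^bsub>Z\<^esub>) = [m] \<cdot>\<^bsub>L\<^esub> \<one>\<^bsub>L\<^esub>" for m :: nat
    by (induction m) (auto simp: h.hom_add)
  have "[p] \<cdot>\<^bsub>Z\<^esub> \<one>\<^bsub>Z\<^esub> = \<zero>\<^bsub>Z\<^esub>" using Zm[of p] by (simp add: Z.res_zero_eq)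
  then have char: "[p] \<cdot>\<^bsub>L\<^esub> \<one>\<^bsub>L\<^esub> = \<zero>\<^bsub>L\<^esub>" using Lm[of p] h.hom_zero by metis
  let ?K = "{x \<in> carrier L. x [^]\<^bsub>L\<^esub> (p ^ n) = x}"
  have "field (L\<lparr>carrier := ?K\<rparr>)"
    using L.subfield_iff(2)[OF L.frobenius_fixed_subfield[OF p char]] .
  then show ?thesis using that[of "L\<lparr>carrier := ?K\<rparr>"] L.card_frobenius_fixed[OF p char n] by simp
qed

subsection \<open>Cyclotomic classes\<close>

text \<open>\<open>A i\<close> is the coset of the subgroup of \<open>2 k\<close>-th powers which contains \<open>g ^ (2 i)\<close>, for a
  primitive element \<open>g\<close>; the index \<open>i\<close> matters only modulo \<open>k\<close>.\<close>

locale cyclotomic_classes = field R for R (structure) +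
  fixes k t :: nat and A :: "nat \<Rightarrow> 'a set"
  assumes finite_carrier: "finite (carrier R)"
    and card_carrier: "card (carrier R) = 2 * k * t + 1"
    and k_ge: "k \<ge> 3"
    and t_pos: "t > 0"
    and class_sub: "A i \<subseteq> carrier R - {\<zero>}"
    and class_mult: "\<lbrakk>x \<in> A i; y \<in> A j\<rbrakk> \<Longrightarrow> x \<otimes> y \<in> A (i + j)"
    and class_div: "\<lbrakk>x \<in> A (i + j); y \<in> A j\<rbrakk> \<Longrightarrow> x \<otimes> inv y \<in> A i"
    and class_unique: "\<lbrakk>x \<in> A i; x \<in> A j\<rbrakk> \<Longrightarrow> [i = j] (mod k)"
    and class_cong: "[i = j] (mod k) \<Longrightarrow> A i = A j"
    and card_class: "card (A i) = t"
    and class_add_nonzero: "\<lbrakk>x \<in> A i; y \<in> A j\<rbrakk> \<Longrightarrow> x \<oplus> y \<noteq> \<zero>"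
    and class_cover: "x \<in> carrier R - {\<zero>} \<Longrightarrow> (\<exists>i. x \<in> A i) \<or> (\<exists>i. \<ominus> x \<in> A i)"
begin

lemma class_closed [simp, intro]: "x \<in> A i \<Longrightarrow> x \<in> carrier R"
  using class_sub by blast

lemma class_unit: "x \<in> A i \<Longrightarrow> x \<in> Units R"
  using class_sub field_Units by blast

lemma class_inv_closed [simp]: "x \<in> A i \<Longrightarrow> inv x \<in> carrier R"
  by (simp add: class_unit)

lemma finite_class: "finite (A i)"
  using finite_subset[OF _ finite_carrier] class_sub by blast

lemma class_mult0: "\<lbrakk>x \<in> A i; y \<in> A 0\<rbrakk> \<Longrightarrow> x \<otimes> y \<in> A i"
  using class_mult[of x i y 0] by simp

lemma class_div0: "\<lbrakk>x \<in> A i; y \<in> A 0\<rbrakk> \<Longrightarrow> x \<otimes> inv y \<in> A i"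
  using class_div[of x i 0 y] by simp

section \<open>Incidences of points and lines, and cyclotomic numbers\<close>

lemma card_translate:
  assumes z: "z \<in> carrier R" and B: "B \<subseteq> carrier R"
  shows "card {y \<in> carrier R. y \<ominus> z \<in> B} = card B"
proof (rule bij_betw_same_card)
  show "bij_betw (\<lambda>y. y \<ominus> z) {y \<in> carrier R. y \<ominus> z \<in> B} B"
  proof (rule bij_betw_byWitness[where f' = "\<lambda>y. y \<oplus> z"])
    show "\<forall>y\<in>{y \<in> carrier R. y \<ominus> z \<in> B}. y \<ominus> z \<oplus> z = y"
      using z by (auto simp: a_minus_def a_assoc l_neg)
    have eq: "y \<oplus> z \<ominus> z = y" if "y \<in> B" for y
      using z B that by (auto simp: a_minus_def a_assoc r_neg)
    then show "\<forall>y\<in>B. y \<oplus> z \<ominus> z = y" by blast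
    show "(\<lambda>y. y \<oplus> z) ` B \<subseteq> {y \<in> carrier R. y \<ominus> z \<in> B}"
      using z B eq by auto
  qed auto
qed

text \<open>Lines of different slopes meet in at most one point, so the two intercepts determine
  \<open>(u, v)\<close>: their difference is \<open>(x' \<ominus> x) \<otimes> u\<close>, which
  gives \<open>u\<close> and then \<open>v\<close>.\<close>

lemma card_two_lines_le:
  assumes x: "x \<in> carrier R" and x': "x' \<in> carrier R" and ne: "x \<noteq> x'" and B: "B \<subseteq> carrier R"
  shows "card {(u, v) \<in> carrier R \<times> carrier R. v \<ominus> x \<otimes> u \<in> B \<and> v \<ominus> x' \<otimes> u \<in> B} \<le> card B * card B"
proof -
  let ?f = "\<lambda>(u, v). (v \<ominus> x \<otimes> u, v \<ominus> x' \<otimes> u)"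
  let ?P = "{(u, v) \<in> carrier R \<times> carrier R. v \<ominus> x \<otimes> u \<in> B \<and> v \<ominus> x' \<otimes> u \<in> B}"
  have "inj_on ?f ?P"
  proof (rule inj_onI, clarsimp)
    fix u v u' v' assume c: "u \<in> carrier R" "v \<in> carrier R" "u' \<in> carrier R" "v' \<in> carrier R"
      and e1: "v \<ominus> x \<otimes> u = v' \<ominus> x \<otimes> u'" and e2: "v \<ominus> x' \<otimes> u = v' \<ominus> x' \<otimes> u'"
    have "(x' \<ominus> x) \<otimes> u = (v \<ominus> x \<otimes> u) \<ominus> (v \<ominus> x' \<otimes> u)" using c x x' by algebra
    also have "\<dots> = (x' \<ominus> x) \<otimes> u'" unfolding e1 e2 using c x x' by algebra
    finally have "u = u'" using c x x' ne by (subst (asm) m_lcancel) auto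
    have "v = (v \<ominus> x \<otimes> u) \<oplus> x \<otimes> u" using c x by algebra
    also have "\<dots> = (v' \<ominus> x \<otimes> u') \<oplus> x \<otimes> u'" unfolding e1 using \<open>u = u'\<close> by simp
    also have "\<dots> = v'" using c x by algebra
    finally show "u = u' \<and> v = v'" using \<open>u = u'\<close> by simp
  qed
  moreover have "?f ` ?P \<subseteq> B \<times> B" by auto
  moreover have "finite (B \<times> B)" using finite_subset[OF B finite_carrier] by simp
  ultimately have "card ?P \<le> card (B \<times> B)" by (rule card_inj_on_le)
  then show ?thesis by (simp add: card_cartesian_product)
qed

text \<open>Let \<open>D u v\<close> be the number of lines \<open>v = x u + y\<close> with \<open>x \<in> A i\<close> and \<open>y \<in> A j\<close> through the
  point \<open>(u, v)\<close>. Its variance over the plane is small, since two lines meet in at most one point,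
  and by homogeneity \<open>D\<close> takes the value to be estimated at all \<open>t\<^sup>2\<close> points of
  \<open>A 0 \<times> c A 0\<close>.\<close>

lemma cyclotomic_number_bound:
  assumes c: "c \<in> carrier R" "c \<noteq> \<zero>"
  defines "q \<equiv> real (card (carrier R))"
  shows "((real t)\<^sup>2 / q - real (card {x \<in> A i. c \<ominus> x \<in> A j}))\<^sup>2 \<le> q - real t"
proof -
  let ?C = "carrier R"
  let ?I = "\<lambda>P. of_bool P :: real"
  have q0: "q > 0" unfolding q_def card_carrier by (simp add: add_pos_nonneg)
  define N where "N = real (card {x \<in> A i. c \<ominus> x \<in> A j})"
  define \<mu> where "\<mu> = (real t)\<^sup>2 / q"
  define D where "D u v = (\<Sum>x\<in>A i. ?I (v \<ominus> x \<otimes> u \<in> A j))" for u v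
  have Dcard: "D u v = real (card {x \<in> A i. v \<ominus> x \<otimes> u \<in> A j})" for u v
    unfolding D_def using finite_class[of i] by (simp add: of_bool_def sum.If_cases Int_def)
  have row: "(\<Sum>v\<in>?C. ?I (v \<ominus> z \<in> A j)) = real t" if "z \<in> ?C" for z
  proof -
    have "(\<Sum>v\<in>?C. ?I (v \<ominus> z \<in> A j)) = real (card {v \<in> ?C. v \<ominus> z \<in> A j})"
      using finite_carrier by (simp add: of_bool_def sum.If_cases Int_def)
    also have "\<dots> = real t" using card_translate[OF that, of "A j"] card_class class_closed by auto
    finally show ?thesis .
  qed
  have S1: "(\<Sum>u\<in>?C. \<Sum>v\<in>?C. D u v) = q * (real t)\<^sup>2"
  proof -
    have "(\<Sum>u\<in>?C. \<Sum>v\<in>?C. D u v) = (\<Sum>u\<in>?C. \<Sum>x\<in>A i. \<Sum>v\<in>?C. ?I (v \<ominus> x \<otimes> u \<in> A j))"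
      unfolding D_def by (intro sum.cong refl sum.swap)
    also have "\<dots> = (\<Sum>u\<in>?C. \<Sum>x\<in>A i. real t)" by (intro sum.cong refl row) auto
    finally show ?thesis by (simp add: card_class q_def power2_eq_square)
  qed
  \<comment> \<open>The square counts pairs of lines through a point. Equal slopes contribute
    \<open>q * t\<close> for each \<open>x\<close>; the \<open>t * (t - 1)\<close> pairs of
    different slopes contribute at most \<open>t * t\<close> each.\<close>
  have S2: "(\<Sum>u\<in>?C. \<Sum>v\<in>?C. (D u v)\<^sup>2) \<le> q * (real t)\<^sup>2 + (real t)^4 - (real t)^3"
  proof -
    let ?E = "\<lambda>x x' u v. v \<ominus> x \<otimes> u \<in> A j \<and> v \<ominus> x' \<otimes> u \<in> A j"
    have "(\<Sum>u\<in>?C. \<Sum>v\<in>?C. (D u v)\<^sup>2) = (\<Sum>(u, v)\<in>?C \<times> ?C. \<Sum>x\<in>A i. \<Sum>x'\<in>A i. ?I (?E x x' u v))"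
      unfolding sum.cartesian_product[symmetric]
      by (simp add: D_def power2_eq_square sum_product of_bool_conj)
    also have "\<dots> = (\<Sum>x\<in>A i. \<Sum>x'\<in>A i. \<Sum>(u, v)\<in>?C \<times> ?C. ?I (?E x x' u v))"
      unfolding split_def by (subst sum.swap, intro sum.cong refl, subst sum.swap) simp
    also have "\<dots> \<le> (\<Sum>x\<in>A i. \<Sum>x'\<in>A i. if x' = x then q * real t else (real t)\<^sup>2)"
    proof (intro sum_mono)
      fix x x' assume x: "x \<in> A i" and x': "x' \<in> A i"
      show "(\<Sum>(u, v)\<in>?C \<times> ?C. ?I (?E x x' u v)) \<le> (if x' = x then q * real t else (real t)\<^sup>2)"
      proof (cases "x' = x")
        case True
        have "(\<Sum>(u, v)\<in>?C \<times> ?C. ?I (?E x x' u v)) = (\<Sum>u\<in>?C. \<Sum>v\<in>?C. ?I (v \<ominus> x \<otimes> u \<in> A j))"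
          using True by (simp add: sum.cartesian_product)
        also have "\<dots> = (\<Sum>u\<in>?C. real t)" using x by (intro sum.cong refl row) auto
        finally show ?thesis using True by (simp add: q_def)
      next
        case False
        have "(\<Sum>(u, v)\<in>?C \<times> ?C. ?I (?E x x' u v)) =
            real (card {(u, v) \<in> ?C \<times> ?C. ?E x x' u v})"
          using finite_carrier by (simp add: split_def of_bool_def sum.If_cases Int_def mem_Times_iff conj_assoc)
        also have "\<dots> \<le> real (t * t)"
          using card_two_lines_le[OF class_closed[OF x] class_closed[OF x'], of "A j"] False
          by (subst of_nat_le_iff) (auto simp: card_class)
        finally show ?thesis using False by (simp add: power2_eq_square)
      qed
    qed
    also have "\<dots> = real t * (q * real t + (real t - 1) * (real t)\<^sup>2)"
    proof -
      have "(\<Sum>x'\<in>A i. if x' = x then q * real t else (real t)\<^sup>2) =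
          q * real t + (real t - 1) * (real t)\<^sup>2" if x: "x \<in> A i" for x
        using x finite_class[of i] t_pos
        by (subst sum.remove[OF _ x]) (auto simp: card_class of_nat_diff)
      then show ?thesis by (simp add: card_class)
    qed
    also have "\<dots> = q * (real t)\<^sup>2 + (real t)^4 - (real t)^3"
      by (simp add: algebra_simps power2_eq_square power3_eq_cube power4_eq_xxxx)
    finally show ?thesis .
  qed
  \<comment> \<open>\<open>\<mu>\<close> is the mean of \<open>D\<close> over the plane. In the
    variance the terms of order t^4 cancel, and t^2 (q - t) is left.\<close>
  have S3: "(\<Sum>u\<in>?C. \<Sum>v\<in>?C. (D u v - \<mu>)\<^sup>2) \<le> (real t)\<^sup>2 * (q - real t)"
  proof -
    have "(\<Sum>u\<in>?C. \<Sum>v\<in>?C. (D u v - \<mu>)\<^sup>2) =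
      (\<Sum>u\<in>?C. \<Sum>v\<in>?C. (D u v)\<^sup>2) - 2 * \<mu> * (\<Sum>u\<in>?C. \<Sum>v\<in>?C. D u v) + q * q * \<mu>\<^sup>2"
      by (simp add: power2_diff sum.distrib sum_subtractf sum_distrib_left q_def mult_ac)
    also have "\<dots> \<le> q * (real t)\<^sup>2 + (real t)^4 - (real t)^3 - 2 * \<mu> * (q * (real t)\<^sup>2) + q * q * \<mu>\<^sup>2"
      using S2 S1 by simp
    also have "\<dots> = (real t)\<^sup>2 * (q - real t)"
      using q0 by (simp add: \<mu>_def field_simps power2_eq_square power3_eq_cube power4_eq_xxxx)
    finally show ?thesis .
  qed
  \<comment> \<open>Dividing \<open>c \<otimes> h \<ominus> x \<otimes> u\<close> by
    \<open>h\<close> and substituting \<open>x \<otimes> u \<otimes> inv h\<close> for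
    \<open>x\<close> changes no class, since \<open>u\<close> and \<open>h\<close> lie in
    \<open>A 0\<close>.\<close>
  have pt: "D u (c \<otimes> h) = N" if u: "u \<in> A 0" and h: "h \<in> A 0" for u h
  proof -
    have "bij_betw (\<lambda>x. x \<otimes> u \<otimes> inv h) {x \<in> A i. c \<otimes> h \<ominus> x \<otimes> u \<in> A j} {x \<in> A i. c \<ominus> x \<in> A j}"
    proof (rule bij_betw_byWitness[where f' = "\<lambda>x. x \<otimes> h \<otimes> inv u"])
      have uu: "u \<in> Units R" and hu: "h \<in> Units R" using u h class_unit by auto
      note cl = class_closed[OF u] class_closed[OF h] class_inv_closed[OF u] class_inv_closed[OF h]
      have i1: "x \<otimes> u \<otimes> inv h \<otimes> h \<otimes> inv u = x" and i2: "x \<otimes> h \<otimes> inv u \<otimes> u \<otimes> inv h = x"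
        and i3: "(c \<otimes> h \<ominus> x \<otimes> u) \<otimes> inv h = c \<ominus> x \<otimes> u \<otimes> inv h"
        and i4: "(c \<ominus> x) \<otimes> h = c \<otimes> h \<ominus> x \<otimes> h \<otimes> inv u \<otimes> u"
        if x: "x \<in> carrier R" for x
      proof -
        note x = x cl c(1)
        have "x \<otimes> u \<otimes> inv h \<otimes> h \<otimes> inv u = x \<otimes> (u \<otimes> inv u) \<otimes> (h \<otimes> inv h)" using x by (simp add: m_ac)
        then show "x \<otimes> u \<otimes> inv h \<otimes> h \<otimes> inv u = x" using x uu hu by simp
        have "x \<otimes> h \<otimes> inv u \<otimes> u \<otimes> inv h = x \<otimes> (u \<otimes> inv u) \<otimes> (h \<otimes> inv h)" using x by (simp add: m_ac)
        then show "x \<otimes> h \<otimes> inv u \<otimes> u \<otimes> inv h = x" using x uu hu by simp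
        have "(c \<otimes> h \<ominus> x \<otimes> u) \<otimes> inv h = c \<otimes> (h \<otimes> inv h) \<ominus> x \<otimes> u \<otimes> inv h" using x by algebra
        then show "(c \<otimes> h \<ominus> x \<otimes> u) \<otimes> inv h = c \<ominus> x \<otimes> u \<otimes> inv h" using x hu by simp
        have "(c \<ominus> x) \<otimes> h = c \<otimes> h \<ominus> x \<otimes> h" using x by algebra
        moreover have "x \<otimes> h \<otimes> inv u \<otimes> u = x \<otimes> h \<otimes> (u \<otimes> inv u)" using x by (simp add: m_ac)
        ultimately show "(c \<ominus> x) \<otimes> h = c \<otimes> h \<ominus> x \<otimes> h \<otimes> inv u \<otimes> u" using x uu by simp
      qed
      show "\<forall>a\<in>{x \<in> A i. c \<otimes> h \<ominus> x \<otimes> u \<in> A j}. a \<otimes> u \<otimes> inv h \<otimes> h \<otimes> inv u = a"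
        "\<forall>a'\<in>{x \<in> A i. c \<ominus> x \<in> A j}. a' \<otimes> h \<otimes> inv u \<otimes> u \<otimes> inv h = a'"
        using i1 i2 by auto
      show "(\<lambda>x. x \<otimes> u \<otimes> inv h) ` {x \<in> A i. c \<otimes> h \<ominus> x \<otimes> u \<in> A j} \<subseteq> {x \<in> A i. c \<ominus> x \<in> A j}"
      proof (clarsimp, intro conjI)
        fix x assume x: "x \<in> A i" and e: "c \<otimes> h \<ominus> x \<otimes> u \<in> A j"
        show "x \<otimes> u \<otimes> inv h \<in> A i" using class_div0[OF class_mult0[OF x u] h] .
        show "c \<ominus> x \<otimes> u \<otimes> inv h \<in> A j" using class_div0[OF e h] i3[OF class_closed[OF x]] by simp
      qed
      show "(\<lambda>x. x \<otimes> h \<otimes> inv u) ` {x \<in> A i. c \<ominus> x \<in> A j} \<subseteq> {x \<in> A i. c \<otimes> h \<ominus> x \<otimes> u \<in> A j}"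
      proof (clarsimp, intro conjI)
        fix x assume x: "x \<in> A i" and e: "c \<ominus> x \<in> A j"
        show "x \<otimes> h \<otimes> inv u \<in> A i" using class_div0[OF class_mult0[OF x h] u] .
        show "c \<otimes> h \<ominus> x \<otimes> h \<otimes> inv u \<otimes> u \<in> A j" using class_mult0[OF e h] i4[OF class_closed[OF x]] by simp
      qed
    qed
    then show ?thesis unfolding Dcard N_def by (simp add: bij_betw_same_card)
  qed
  have S4: "(real t)\<^sup>2 * (N - \<mu>)\<^sup>2 \<le> (\<Sum>u\<in>?C. \<Sum>v\<in>?C. (D u v - \<mu>)\<^sup>2)"
  proof -
    have inj: "inj_on (\<lambda>h. c \<otimes> h) (A 0)"
      using c class_closed m_lcancel by (intro inj_onI) auto
    have "(real t)\<^sup>2 * (N - \<mu>)\<^sup>2 = (\<Sum>u\<in>A 0. \<Sum>h\<in>A 0. (N - \<mu>)\<^sup>2)"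
      by (simp add: card_class power2_eq_square)
    also have "\<dots> = (\<Sum>u\<in>A 0. \<Sum>h\<in>A 0. (D u (c \<otimes> h) - \<mu>)\<^sup>2)"
      using pt by (intro sum.cong refl) auto
    also have "\<dots> = (\<Sum>u\<in>A 0. \<Sum>v\<in>(\<lambda>h. c \<otimes> h) ` A 0. (D u v - \<mu>)\<^sup>2)"
      by (simp add: sum.reindex[OF inj])
    also have "\<dots> \<le> (\<Sum>u\<in>A 0. \<Sum>v\<in>?C. (D u v - \<mu>)\<^sup>2)"
      using c finite_carrier by (intro sum_mono sum_mono2) auto
    also have "\<dots> \<le> (\<Sum>u\<in>?C. \<Sum>v\<in>?C. (D u v - \<mu>)\<^sup>2)"
      using finite_carrier by (intro sum_mono2) (auto intro: sum_nonneg)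
    finally show ?thesis .
  qed
  have "(real t)\<^sup>2 * (\<mu> - N)\<^sup>2 \<le> (real t)\<^sup>2 * (q - real t)"
    using S3 S4 by (simp add: power2_commute)
  then have "(\<mu> - N)\<^sup>2 \<le> q - real t" using t_pos by simp
  then show ?thesis unfolding \<mu>_def N_def .
qed


subsection \<open>Zero-sum blocks with distinct ratios\<close>

definition ratio :: "(nat \<Rightarrow> 'a) \<Rightarrow> nat \<Rightarrow> nat \<Rightarrow> 'a" where
  "ratio b i j = b i \<otimes> inv (b j)"

definition ratios :: "(nat \<Rightarrow> 'a) \<Rightarrow> nat \<Rightarrow> 'a set" where
  "ratios b m = {ratio b i j | i j. i < m \<and> j < m \<and> i \<noteq> j}"

text \<open>A block is a sequence, so that position \<open>i\<close> also records the class. Only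
  the first \<open>m\<close> entries count, which allows growth one element at a time;
  \<open>S\<close> is meant for the ratios already taken by other blocks.\<close>

definition good_block :: "'a set \<Rightarrow> nat \<Rightarrow> (nat \<Rightarrow> 'a) \<Rightarrow> bool" where
  "good_block S m b \<longleftrightarrow> (\<forall>i<m. b i \<in> A i) \<and> ratios b m \<inter> S = {} \<and>
     inj_on (\<lambda>(i, j). ratio b i j) {(i, j). i < m \<and> j < m \<and> i \<noteq> j}"

lemma inv_div:
  assumes "x \<in> Units R" "y \<in> Units R"
  shows "inv (x \<otimes> inv y) = y \<otimes> inv x"
proof (rule comm_inv_char)
  have cl: "x \<in> carrier R" "y \<in> carrier R" "inv x \<in> carrier R" "inv y \<in> carrier R" using assms by auto
  have "x \<otimes> inv y \<otimes> (y \<otimes> inv x) = (x \<otimes> inv x) \<otimes> (y \<otimes> inv y)" using cl by algebra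
  then show "x \<otimes> inv y \<otimes> (y \<otimes> inv x) = \<one>" using assms by simp
qed (use assms in auto)

lemma div_eq_iff:
  assumes "x \<in> carrier R" "y \<in> Units R" "z \<in> carrier R" "w \<in> Units R"
  shows "x \<otimes> inv y = z \<otimes> inv w \<longleftrightarrow> x \<otimes> w = z \<otimes> y"
proof -
  have cl: "y \<in> carrier R" "w \<in> carrier R" "inv y \<in> carrier R" "inv w \<in> carrier R"
    using assms by auto
  have u: "y \<otimes> w \<in> Units R" using assms by auto
  have 1: "(x \<otimes> inv y) \<otimes> (y \<otimes> w) = x \<otimes> w"
  proof -
    have "(x \<otimes> inv y) \<otimes> (y \<otimes> w) = x \<otimes> w \<otimes> (y \<otimes> inv y)" using assms cl by algebra
    then show ?thesis using assms cl by simp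
  qed
  have 2: "(z \<otimes> inv w) \<otimes> (y \<otimes> w) = z \<otimes> y"
  proof -
    have "(z \<otimes> inv w) \<otimes> (y \<otimes> w) = z \<otimes> y \<otimes> (w \<otimes> inv w)" using assms cl by algebra
    then show ?thesis using assms cl by simp
  qed
  have "y \<otimes> w \<noteq> \<zero>" using u field_Units by auto
  then have "(x \<otimes> inv y) \<otimes> (y \<otimes> w) = (z \<otimes> inv w) \<otimes> (y \<otimes> w) \<longleftrightarrow> x \<otimes> inv y = z \<otimes> inv w"
    using assms cl by (intro m_rcancel) auto
  then show ?thesis unfolding 1 2 by simp
qed

text \<open>Class indices are natural numbers read modulo \<open>k\<close>, and
  \<open>(k - 1) * j\<close> plays the part of -j there.\<close>

lemma class_div':
  assumes "x \<in> A i" "y \<in> A j"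
  shows "x \<otimes> inv y \<in> A (i + (k - 1) * j)"
proof -
  have "i + (k - 1) * j + j = i + k * j" using k_ge by (cases k) auto
  then have "[i = i + (k - 1) * j + j] (mod k)" by (simp only:) (simp add: cong_def)
  then show ?thesis using class_div[of x "i + (k - 1) * j" j y] class_cong assms by auto
qed

lemma div_class_unique:
  assumes "x \<in> A i" "y \<in> A j" "x \<otimes> inv y \<in> A d"
  shows "[i = d + j] (mod k)"
proof -
  have "x \<otimes> inv y \<otimes> y = x" using assms class_unit by (simp add: m_assoc)
  then have "x \<in> A (d + j)" using class_mult[OF assms(3,2)] by simp
  then show ?thesis using class_unique assms by blast
qed

lemma class_neq: "\<lbrakk>x \<in> A i; y \<in> A j; i < k; j < k; i \<noteq> j\<rbrakk> \<Longrightarrow> x \<noteq> y"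
  using class_unique cong_less_modulus_unique_nat by blast

text \<open>The other square root is the negative, which lies in no class. Hence an equation for
  \<open>x \<otimes> x\<close> excludes at most one candidate.\<close>

lemma square_class_inj:
  assumes "x \<in> A i" "y \<in> A j" "x \<otimes> x = y \<otimes> y"
  shows "x = y"
proof -
  have c: "x \<in> carrier R" "y \<in> carrier R" using assms by auto
  have "(x \<ominus> y) \<otimes> (x \<oplus> y) = x \<otimes> x \<ominus> y \<otimes> y" using c by algebra
  then have "(x \<ominus> y) \<otimes> (x \<oplus> y) = \<zero>" using assms(3) c by simp
  then have "x \<ominus> y = \<zero>" using class_add_nonzero[OF assms(1,2)] c integral by blast
  then show ?thesis using c by simp
qed

text \<open>The ratio at positions i, j lies in class i - j, so inside class \<open>d\<close> the
  denominator's position fixes the numerator's. This saves a factor of about k over counting all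
  ratios of the block.\<close>

lemma card_ratios_class:
  assumes g: "\<And>i. i < m \<Longrightarrow> b i \<in> A i" and m: "m \<le> k"
  shows "card (ratios b m \<inter> A d) \<le> m"
proof -
  have "ratios b m \<inter> A d \<subseteq> (\<lambda>j. ratio b ((d + j) mod k) j) ` {..<m}"
  proof
    fix z assume "z \<in> ratios b m \<inter> A d"
    then obtain i j where ij: "i < m" "j < m" and z: "z = ratio b i j" "z \<in> A d"
      unfolding ratios_def by auto
    have "[i = d + j] (mod k)" using div_class_unique g ij z unfolding ratio_def by blast
    then have "i = (d + j) mod k" using ij m by (simp add: cong_def)
    then show "z \<in> (\<lambda>j. ratio b ((d + j) mod k) j) ` {..<m}" using ij z by blast
  qed
  then have "card (ratios b m \<inter> A d) \<le> card ((\<lambda>j. ratio b ((d + j) mod k) j) ` {..<m})"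
    by (intro card_mono) auto
  also have "\<dots> \<le> m" using card_image_le[of "{..<m}"] by simp
  finally show ?thesis .
qed

lemma card_div_in_le:
  assumes y: "y \<in> A i"
  shows "card {x \<in> A m. x \<otimes> inv y \<in> T} \<le> card (T \<inter> A (m + (k - 1) * i))"
proof (rule card_inj_on_le)
  show "inj_on (\<lambda>x. x \<otimes> inv y) {x \<in> A m. x \<otimes> inv y \<in> T}"
  proof (rule inj_onI)
    fix x x' assume "x \<in> {x \<in> A m. x \<otimes> inv y \<in> T}" "x' \<in> {x \<in> A m. x \<otimes> inv y \<in> T}"
      and e: "x \<otimes> inv y = x' \<otimes> inv y"
    then have "x \<otimes> y = x' \<otimes> y" using div_eq_iff[of x y x' y] y class_unit by auto
    then show "x = x'" using y class_unit \<open>x \<in> _\<close> \<open>x' \<in> _\<close> class_sub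
      by (metis (no_types, lifting) Units_closed Units_r_inv class_closed m_assoc mem_Collect_eq r_one class_inv_closed)
  qed
  show "(\<lambda>x. x \<otimes> inv y) ` {x \<in> A m. x \<otimes> inv y \<in> T} \<subseteq> T \<inter> A (m + (k - 1) * i)"
    using class_div' y by auto
  show "finite (T \<inter> A (m + (k - 1) * i))" using finite_class by auto
qed

lemma card_square_eq_le: "card {x \<in> A m. x \<otimes> x = d} \<le> 1"
proof -
  have "x = x'" if "x \<in> A m" "x \<otimes> x = d" "x' \<in> A m" "x' \<otimes> x' = d" for x x'
    using square_class_inj[of x m x' m] that by simp
  then show ?thesis using finite_class[of m] by (subst One_nat_def, subst card_le_Suc0_iff_eq) auto
qed

text \<open>Vieta: given one root \<open>r\<close>, the only other possible root is
  \<open>a \<ominus> r\<close>; no discriminant is involved.\<close>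

lemma card_quadratic_le:
  assumes a: "a \<in> carrier R" and d: "d \<in> carrier R"
  shows "card {x \<in> carrier R. x \<otimes> x = a \<otimes> x \<oplus> d} \<le> 2"
proof (cases "\<exists>x \<in> carrier R. x \<otimes> x = a \<otimes> x \<oplus> d")
  case True
  then obtain r where r: "r \<in> carrier R" "r \<otimes> r = a \<otimes> r \<oplus> d" by blast
  have "{x \<in> carrier R. x \<otimes> x = a \<otimes> x \<oplus> d} \<subseteq> {r, a \<ominus> r}"
  proof
    fix x assume "x \<in> {x \<in> carrier R. x \<otimes> x = a \<otimes> x \<oplus> d}"
    then have x: "x \<in> carrier R" "x \<otimes> x = a \<otimes> x \<oplus> d" by auto
    have "(x \<ominus> r) \<otimes> (x \<ominus> (a \<ominus> r)) = (x \<otimes> x \<ominus> a \<otimes> x) \<ominus> (r \<otimes> r \<ominus> a \<otimes> r)"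
      using x(1) r(1) a by algebra
    also have "\<dots> = \<zero>" unfolding x(2) r(2) using x(1) r(1) a d by algebra
    finally have "x \<ominus> r = \<zero> \<or> x \<ominus> (a \<ominus> r) = \<zero>" using x(1) r(1) a integral by blast
    then show "x \<in> {r, a \<ominus> r}" using x(1) r(1) a by auto
  qed
  then have "card {x \<in> carrier R. x \<otimes> x = a \<otimes> x \<oplus> d} \<le> card {r, a \<ominus> r}" by (intro card_mono) auto
  also have "\<dots> \<le> 2" by (simp add: card_insert_if)
  finally show ?thesis .
next
  case False
  then have "{x \<in> carrier R. x \<otimes> x = a \<otimes> x \<oplus> d} = {}" by blast
  then show ?thesis by (metis card.empty le0)
qed

lemma ratios_extend:
  "ratios (b(m := x)) (Suc m) = ratios b m \<union> (\<lambda>j. x \<otimes> inv (b j)) ` {..<m} \<union> (\<lambda>j. b j \<otimes> inv x) ` {..<m}"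
  (is "?L = ?M")
proof
  show "?L \<subseteq> ?M"
  proof
    fix r assume "r \<in> ?L"
    then obtain i j where ij: "i < Suc m" "j < Suc m" "i \<noteq> j" "r = ratio (b(m := x)) i j"
      unfolding ratios_def by blast
    consider "i = m" "j < m" | "i < m" "j = m" | "i < m" "j < m" using ij by linarith
    then show "r \<in> ?M"
    proof cases
      case 3
      then show ?thesis using ij unfolding ratios_def by (auto simp: ratio_def)
    qed (use ij in \<open>auto simp: ratio_def\<close>)
  qed
  have 1: "ratio (b(m := x)) i j \<in> ?L" if "i < Suc m" "j < Suc m" "i \<noteq> j" for i j
    using that unfolding ratios_def by blast
  have "x \<otimes> inv (b j) \<in> ?L" "b j \<otimes> inv x \<in> ?L" if "j < m" for j
    using 1[of m j] 1[of j m] that by (simp_all add: ratio_def)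
  moreover have "ratios b m \<subseteq> ?L"
  proof
    fix r assume "r \<in> ratios b m"
    then obtain i j where "i < m" "j < m" "i \<noteq> j" "r = ratio b i j" unfolding ratios_def by blast
    then show "r \<in> ?L" using 1[of i j] by (simp add: ratio_def)
  qed
  ultimately show "?M \<subseteq> ?L" by blast
qed

lemma ratios_inv:
  assumes g: "\<And>i. i < m \<Longrightarrow> b i \<in> A i" and r: "r \<in> ratios b m"
  shows "inv r \<in> ratios b m"
proof -
  obtain i j where ij: "i < m" "j < m" "i \<noteq> j" "r = ratio b i j" using r unfolding ratios_def by blast
  then have "inv r = ratio b j i" using inv_div[OF class_unit[OF g] class_unit[OF g]] unfolding ratio_def by simp
  then show ?thesis using ij unfolding ratios_def by blast
qed

section \<open>Extending a block without repeating a ratio\<close>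

text \<open>The new ratios are x / b_i and b_i / x. Two of the same kind agree only if two block
  elements agree, which their classes forbid; two of different kinds agree only if x^2 = b_i b_j,
  excluded by \<open>sq\<close>. A clash of x / b_i with an old ratio or with \<open>S\<close> is
  excluded by \<open>new\<close>, and the one of b_i / x follows because both sets are closed under
  inversion.\<close>

lemma good_block_extend:
  assumes g: "good_block S m b" and S: "\<And>s. s \<in> S \<Longrightarrow> inv s \<in> S" and m: "m < k" and x: "x \<in> A m"
    and new: "\<And>i. i < m \<Longrightarrow> x \<otimes> inv (b i) \<notin> S \<union> ratios b m"
    and sq: "\<And>i j. i < m \<Longrightarrow> j < m \<Longrightarrow> x \<otimes> x \<noteq> b i \<otimes> b j"
  shows "good_block S (Suc m) (b(m := x))"
proof -
  have b: "\<And>i. i < m \<Longrightarrow> b i \<in> A i" using g unfolding good_block_def by blast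
  have bu: "\<And>i. i < m \<Longrightarrow> b i \<in> Units R" and xu: "x \<in> Units R" using b x class_unit by auto
  have bc: "\<And>i. i < m \<Longrightarrow> b i \<in> carrier R" and xc: "x \<in> carrier R" using b x by auto
  have b_inj: "i = j" if "i < m" "j < m" "b i = b j" for i j
    using class_neq[OF b[OF that(1)] b[OF that(2)]] that m by auto
  have new': "b i \<otimes> inv x \<notin> S \<union> ratios b m" if i: "i < m" for i
    using inv_div[OF bu[OF i] xu] S[of "b i \<otimes> inv x"] ratios_inv[OF b, of m "b i \<otimes> inv x"] new[OF i] by auto
  have aa: "i = j" if "i < m" "j < m" "x \<otimes> inv (b i) = x \<otimes> inv (b j)" for i j
  proof -
    have "x \<otimes> b j = x \<otimes> b i" using that div_eq_iff[of x "b i" x "b j"] xc bu by simp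
    then have "b i = b j" using x class_sub bc that by (subst (asm) m_lcancel) auto
    then show ?thesis using b_inj that by blast
  qed
  have bb: "i = j" if "i < m" "j < m" "b i \<otimes> inv x = b j \<otimes> inv x" for i j
  proof -
    have "b i \<otimes> x = b j \<otimes> x" using that div_eq_iff[of "b i" x "b j" x] xu bc by simp
    then have "b i = b j" using x class_sub bc that by (subst (asm) m_rcancel) auto
    then show ?thesis using b_inj that by blast
  qed
  have ab: "x \<otimes> inv (b i) \<noteq> b j \<otimes> inv x" if "i < m" "j < m" for i j
    using that div_eq_iff[of x "b i" "b j" x] xu bu bc xc sq by (metis m_comm)
  have old: "i = i' \<and> j = j'" if "i < m" "j < m" "i \<noteq> j" "i' < m" "j' < m" "i' \<noteq> j'"
    "b i \<otimes> inv (b j) = b i' \<otimes> inv (b j')" for i j i' j'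
  proof -
    have "inj_on (\<lambda>(i, j). ratio b i j) {(i, j). i < m \<and> j < m \<and> i \<noteq> j}"
      using g unfolding good_block_def by blast
    from inj_onD[OF this, of "(i, j)" "(i', j')"] show ?thesis using that unfolding ratio_def by simp
  qed
  have oldin: "b i \<otimes> inv (b j) \<in> ratios b m" if "i < m" "j < m" "i \<noteq> j" for i j
    using that unfolding ratios_def ratio_def by blast
  have "inj_on (\<lambda>(i, j). ratio (b(m := x)) i j) {(i, j). i < Suc m \<and> j < Suc m \<and> i \<noteq> j}"
  proof (rule inj_onI, clarify)
    fix i j i' j' assume ij: "i < Suc m" "j < Suc m" "i \<noteq> j" "i' < Suc m" "j' < Suc m" "i' \<noteq> j'"
      and e: "ratio (b(m := x)) i j = ratio (b(m := x)) i' j'"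
    consider "i = m" "j < m" | "i < m" "j = m" | "i < m" "j < m" using ij by linarith
    then show "i = i' \<and> j = j'"
    proof cases
      case 1
      consider "i' = m" "j' < m" | "i' < m" "j' = m" | "i' < m" "j' < m" using ij by linarith
      then show ?thesis
      proof cases
        case 1 then show ?thesis using \<open>i = m\<close> \<open>j < m\<close> e aa[of j j'] by (simp add: ratio_def)
      next
        case 2 then show ?thesis using \<open>i = m\<close> \<open>j < m\<close> e ab[of j i'] by (simp add: ratio_def)
      next
        case 3 then show ?thesis using \<open>i = m\<close> \<open>j < m\<close> e new[of j] oldin[of i' j'] ij by (simp add: ratio_def)
      qed
    next
      case 2
      consider "i' = m" "j' < m" | "i' < m" "j' = m" | "i' < m" "j' < m" using ij by linarith
      then show ?thesis
      proof cases
        case 1 then show ?thesis using \<open>i < m\<close> \<open>j = m\<close> e ab[of j' i] by (simp add: ratio_def)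
      next
        case 2 then show ?thesis using \<open>i < m\<close> \<open>j = m\<close> e bb[of i i'] by (simp add: ratio_def)
      next
        case 3 then show ?thesis using \<open>i < m\<close> \<open>j = m\<close> e new'[of i] oldin[of i' j'] ij by (simp add: ratio_def)
      qed
    next
      case 3
      note c3 = 3
      consider "i' = m" "j' < m" | "i' < m" "j' = m" | "i' < m" "j' < m" using ij by linarith
      then show ?thesis
      proof cases
        case 1 then show ?thesis using c3 e new[of j'] oldin[of i j] ij by (simp add: ratio_def)
      next
        case 2 then show ?thesis using c3 e new'[of i'] oldin[of i j] ij by (simp add: ratio_def)
      next
        case 3 then show ?thesis using c3 e old[of i j i' j'] ij by (simp add: ratio_def)
      qed
    qed
  qed
  moreover have "ratios (b(m := x)) (Suc m) \<inter> S = {}"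
    unfolding ratios_extend using g new new' unfolding good_block_def by auto
  moreover have "\<forall>i<Suc m. (b(m := x)) i \<in> A i" using b x by (auto simp: less_Suc_eq)
  ultimately show ?thesis unfolding good_block_def by blast
qed

text \<open>Two extensions in a row, but with all conditions stated over the original
  \<open>b\<close>. Since \<open>y\<close> will be \<open>c \<ominus> x\<close>, they become
  conditions on \<open>x\<close> alone whose solutions can be counted one by one.\<close>

lemma good_block_final:
  assumes g: "good_block S m b" and S: "\<And>s. s \<in> S \<Longrightarrow> inv s \<in> S" and m: "k = Suc (Suc m)"
    and x: "x \<in> A m" and y: "y \<in> A (Suc m)"
    and x1: "\<And>i. i < m \<Longrightarrow> x \<otimes> inv (b i) \<notin> S \<union> ratios b m"
    and x2: "\<And>i j. i < m \<Longrightarrow> j < m \<Longrightarrow> x \<otimes> x \<noteq> b i \<otimes> b j"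
    and y1: "\<And>i. i < m \<Longrightarrow> y \<otimes> inv (b i) \<notin> S \<union> ratios b m"
    and y2: "\<And>i j. i < m \<Longrightarrow> j < m \<Longrightarrow> y \<otimes> y \<noteq> b i \<otimes> b j"
    and yx: "y \<otimes> inv x \<notin> S \<union> ratios b m"
    and xy: "\<And>i j. i < m \<Longrightarrow> j < m \<Longrightarrow> x \<otimes> y \<noteq> b i \<otimes> b j"
    and xxy: "\<And>i. i < m \<Longrightarrow> x \<otimes> x \<noteq> y \<otimes> b i"
    and yyx: "\<And>i. i < m \<Longrightarrow> y \<otimes> y \<noteq> x \<otimes> b i"
  shows "good_block S k (b(m := x, Suc m := y))"
proof -
  let ?b = "b(m := x)"
  have b: "\<And>i. i < m \<Longrightarrow> b i \<in> A i" using g unfolding good_block_def by blast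
  have bu: "\<And>i. i < m \<Longrightarrow> b i \<in> Units R" and xu: "x \<in> Units R" and yu: "y \<in> Units R"
    using b x y class_unit by auto
  have bc: "\<And>i. i < m \<Longrightarrow> b i \<in> carrier R" and xc: "x \<in> carrier R" and yc: "y \<in> carrier R"
    using b x y by auto
  have yb: "y \<noteq> b i" if "i < m" for i using class_neq[OF y b[OF that]] that m by auto
  have yx': "y \<noteq> x" using class_neq[OF y x] m by auto
  have g1: "good_block S (Suc m) ?b" using good_block_extend[OF g S _ x x1 x2] m by simp
  have "good_block S (Suc (Suc m)) (?b(Suc m := y))"
  proof (rule good_block_extend[OF g1 S _ y])
    show "Suc m < k" using m by simp
  next
    fix i assume i: "i < Suc m"
    show "y \<otimes> inv (?b i) \<notin> S \<union> ratios ?b (Suc m)"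
    proof (cases "i = m")
      case True
      have "y \<otimes> inv x \<noteq> x \<otimes> inv (b j)" if "j < m" for j
        using div_eq_iff[OF yc xu xc bu[OF that]] xxy[OF that] by auto
      moreover have "y \<otimes> inv x \<noteq> b j \<otimes> inv x" if "j < m" for j
      proof
        assume "y \<otimes> inv x = b j \<otimes> inv x"
        then have "y \<otimes> x = b j \<otimes> x" using div_eq_iff[OF yc xu bc[OF that] xu] by simp
        then show False using yb[OF that] yc bc[OF that] x class_sub by (subst (asm) m_rcancel) auto
      qed
      ultimately show ?thesis using True yx unfolding ratios_extend by auto
    next
      case False
      then have im: "i < m" using i by simp
      \<comment> \<open>Such an equality rearranges to y / x = b_i / b_j. For i = j this says y = x;
        otherwise it is an old ratio, already excluded by \<open>yx\<close>.\<close>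
      have "y \<otimes> inv (b i) \<noteq> x \<otimes> inv (b j)" if j: "j < m" for j
      proof
        assume "y \<otimes> inv (b i) = x \<otimes> inv (b j)"
        then have e: "y \<otimes> b j = x \<otimes> b i" using div_eq_iff[OF yc bu[OF im] xc bu[OF j]] by simp
        show False
        proof (cases "i = j")
          case True
          then have "y \<otimes> b j = x \<otimes> b j" using e by simp
          then show False using yx' yc xc bc[OF j] b[OF j] class_sub by (subst (asm) m_rcancel) auto
        next
          case False
          have "y \<otimes> inv x = b i \<otimes> inv (b j)"
            using e div_eq_iff[OF yc xu bc[OF im] bu[OF j]] m_comm[OF xc bc[OF im]] by simp
          then have "y \<otimes> inv x \<in> ratios b m" using False im j unfolding ratios_def ratio_def by blast
          then show False using yx by blast
        qed
      qed
      moreover have "y \<otimes> inv (b i) \<noteq> b j \<otimes> inv x" if j: "j < m" for j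
        using div_eq_iff[OF yc bu[OF im] bc[OF j] xu] xy[OF j im] m_comm[OF xc yc] by auto
      ultimately show ?thesis using False y1[OF im] unfolding ratios_extend by auto
    qed
  next
    fix i j assume ij: "i < Suc m" "j < Suc m"
    have "y \<otimes> y \<noteq> x \<otimes> x" using square_class_inj[OF y x] yx' by blast
    moreover have "y \<otimes> y \<noteq> b i \<otimes> x" if "i < m" for i using yyx[OF that] m_comm[OF xc bc[OF that]] by simp
    ultimately show "y \<otimes> y \<noteq> ?b i \<otimes> ?b j"
      using ij y2 yyx by (auto simp: less_Suc_eq)
  qed
  then show ?thesis using m by simp
qed


section \<open>Choosing the elements of a block by counting exclusions\<close>

lemma finsum_lessThan_Suc:
  "(\<And>i. i \<le> n \<Longrightarrow> f i \<in> carrier R) \<Longrightarrow> (\<Oplus>i\<in>{..<Suc n}. f i) = f n \<oplus> (\<Oplus>i\<in>{..<n}. f i)"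
  by (subst lessThan_Suc, subst finsum_insert) auto

lemma card_less_obtain:
  assumes "card B < card C" "finite B"
  obtains x where "x \<in> C" "x \<notin> B"
  using assms card_mono[of B C] by (meson leD subsetI)

text \<open>The quotient of \<open>x\<close> by \<open>y\<close> lies in class l - i, which is
  nonzero modulo \<open>k\<close>. That class holds at most \<open>M\<close> elements of
  \<open>S\<close> and at most \<open>m\<close> ratios of the block, and \<open>x\<close> is
  recovered from the quotient.\<close>

lemma card_forbidden_le:
  assumes b: "\<And>i. i < m \<Longrightarrow> b i \<in> A i" and m: "m \<le> k"
    and S: "\<And>d. \<not> [d = 0] (mod k) \<Longrightarrow> card (S \<inter> A d) \<le> M"
    and y: "y \<in> A i" "i < k" "l < k" "i \<noteq> l"
  shows "card {x \<in> A l. x \<otimes> inv y \<in> S \<union> ratios b m} \<le> M + m"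
proof -
  let ?d = "l + (k - 1) * i"
  have "\<not> [?d = 0] (mod k)"
  proof
    assume "[?d = 0] (mod k)"
    then have "[?d + i = 0 + i] (mod k)" by (intro cong_add) auto
    moreover have e: "?d + i = l + k * i" using k_ge by (cases k) auto
    ultimately have "[l + k * i = i] (mod k)" unfolding e by simp
    then have "[l = i] (mod k)" by (simp add: cong_def)
    then show False using y cong_less_modulus_unique_nat by blast
  qed
  then have "card ((S \<union> ratios b m) \<inter> A ?d) \<le> M + m"
    using S[of ?d] card_ratios_class[OF b m, of ?d] card_Un_le[of "S \<inter> A ?d" "ratios b m \<inter> A ?d"]
    by (simp add: Int_Un_distrib2)
  then show ?thesis using card_div_in_le[OF y(1), of l "S \<union> ratios b m"] by linarith
qed

lemma card_UN_pairs_le: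
  assumes "\<And>i j. i < m \<Longrightarrow> j < m \<Longrightarrow> card (B i j) \<le> (n::nat)"
  shows "card (\<Union>(i, j)\<in>{..<m} \<times> {..<m}. B i j) \<le> m * m * n"
proof -
  have "card (\<Union>(i, j)\<in>{..<m} \<times> {..<m}. B i j) \<le> (\<Sum>(i, j)\<in>{..<m} \<times> {..<m}. card (B i j))"
    using card_UN_le[of "{..<m} \<times> {..<m}" "\<lambda>(i, j). B i j"] by (simp add: split_def)
  also have "\<dots> \<le> (\<Sum>(i, j)\<in>{..<m} \<times> {..<m}. n)" using assms by (intro sum_mono) auto
  finally show ?thesis by simp
qed

lemma card_UN_lessThan_le:
  assumes "\<And>i. i < m \<Longrightarrow> card (B i) \<le> (n::nat)"
  shows "card (\<Union>i\<in>{..<m}. B i) \<le> m * n"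
proof -
  have "card (\<Union>i\<in>{..<m}. B i) \<le> (\<Sum>i\<in>{..<m}. card (B i))" by (rule card_UN_le) simp
  also have "\<dots> \<le> (\<Sum>i\<in>{..<m}. n)" using assms by (intro sum_mono) auto
  finally show ?thesis by simp
qed

text \<open>The sum is kept nonzero because its negative becomes the prescribed sum \<open>c\<close>
  of the last two elements, and the estimate for the number of such pairs requires
  \<open>c \<noteq> \<zero>\<close>.\<close>

lemma greedy_block:
  assumes S: "\<And>s. s \<in> S \<Longrightarrow> inv s \<in> S"
    and SM: "\<And>d. \<not> [d = 0] (mod k) \<Longrightarrow> card (S \<inter> A d) \<le> M"
    and t: "k * (M + k) + k * k + 1 < t"
  shows "m \<le> k \<Longrightarrow> \<exists>b. good_block S m b \<and> (m > 0 \<longrightarrow> (\<Oplus>i\<in>{..<m}. b i) \<noteq> \<zero>)"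
proof (induction m)
  case 0
  show ?case by (auto simp: good_block_def ratios_def)
next
  case (Suc m)
  then obtain b where g: "good_block S m b" by auto
  have b: "\<And>i. i < m \<Longrightarrow> b i \<in> A i" using g unfolding good_block_def by blast
  have m: "m < k" using Suc by simp
  define s where "s = (\<Oplus>i\<in>{..<m}. b i)"
  have s: "s \<in> carrier R" unfolding s_def using b by (intro finsum_closed) auto
  let ?B1 = "\<Union>i\<in>{..<m}. {x \<in> A m. x \<otimes> inv (b i) \<in> S \<union> ratios b m}"
  let ?B2 = "\<Union>(i, j)\<in>{..<m} \<times> {..<m}. {x \<in> A m. x \<otimes> x = b i \<otimes> b j}"
  have c1: "card ?B1 \<le> m * (M + m)"
  proof (rule card_UN_lessThan_le)
    fix i assume "i < m"
    then show "card {x \<in> A m. x \<otimes> inv (b i) \<in> S \<union> ratios b m} \<le> M + m"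
      using m by (intro card_forbidden_le[OF b _ SM b]) auto
  qed
  have c2: "card ?B2 \<le> m * m * 1" by (intro card_UN_pairs_le card_square_eq_le)
  \<comment> \<open>The single value \<open>\<ominus> s\<close> would make the new partial sum
    vanish; it accounts for the summand 1.\<close>
  have "card (?B1 \<union> ?B2 \<union> {\<ominus> s}) \<le> card ?B1 + card ?B2 + 1"
    using card_Un_le[of "?B1 \<union> ?B2" "{\<ominus> s}"] card_Un_le[of ?B1 ?B2] by simp
  also have "\<dots> \<le> m * (M + m) + m * m + 1" using c1 c2 by simp
  also have "\<dots> \<le> k * (M + k) + k * k + 1" using m by (intro add_mono mult_mono) auto
  also have "\<dots> < card (A m)" using t by (simp add: card_class)
  finally have "card (?B1 \<union> ?B2 \<union> {\<ominus> s}) < card (A m)" .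
  moreover have "finite (?B1 \<union> ?B2 \<union> {\<ominus> s})" by (auto simp: finite_class)
  ultimately obtain x where "x \<in> A m" "x \<notin> ?B1 \<union> ?B2 \<union> {\<ominus> s}" by (rule card_less_obtain)
  then have x: "x \<in> A m" "x \<notin> ?B1" "x \<notin> ?B2" "x \<noteq> \<ominus> s" by simp_all
  have "good_block S (Suc m) (b(m := x))"
    using x by (intro good_block_extend[OF g S m]) auto
  moreover have "(\<Oplus>i\<in>{..<Suc m}. (b(m := x)) i) = x \<oplus> s"
  proof -
    have "(\<Oplus>i\<in>{..<Suc m}. (b(m := x)) i) = x \<oplus> (\<Oplus>i\<in>{..<m}. (b(m := x)) i)"
      using b x by (subst finsum_lessThan_Suc) (auto simp: le_less)
    also have "(\<Oplus>i\<in>{..<m}. (b(m := x)) i) = s"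
      unfolding s_def using b by (intro finsum_cong') auto
    finally show ?thesis .
  qed
  moreover have "x \<oplus> s \<noteq> \<zero>" using x s minus_equality[of x s] by auto
  ultimately show ?case by metis
qed

text \<open>The greedy choice stops after \<open>m\<close>, that is k - 2, elements; the last two
  are then found together. Hypothesis \<open>N\<close> isolates the arithmetic: any number within
  the variance bound exceeds the total of the exclusions, and it is used for the size of the
  candidate set.\<close>

lemma block_exists:
  assumes S: "\<And>s. s \<in> S \<Longrightarrow> inv s \<in> S"
    and SM: "\<And>d. \<not> [d = 0] (mod k) \<Longrightarrow> card (S \<inter> A d) \<le> M"
    and t: "k * (M + k) + k * k + 1 < t"
    and k: "k = Suc (Suc m)"
    and N: "\<And>N. ((real t)\<^sup>2 / real (2 * k * t + 1) - real N)\<^sup>2 \<le> real (2 * k * t + 1) - real t \<Longrightarrow>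
      2 * (m * (M + m)) + 4 * (m * m) + (M + m) + 4 * m < N"
  shows "\<exists>b. good_block S k b \<and> (\<Oplus>i\<in>{..<k}. b i) = \<zero>"
proof -
  have "m > 0" using k k_ge by simp
  then obtain b where g: "good_block S m b" and s0: "(\<Oplus>i\<in>{..<m}. b i) \<noteq> \<zero>"
    using greedy_block[OF S SM t, of m] k by auto
  have b: "\<And>i. i < m \<Longrightarrow> b i \<in> A i" using g unfolding good_block_def by blast
  have bc: "\<And>i. i < m \<Longrightarrow> b i \<in> carrier R" using b by auto
  have mk: "m < k" "Suc m < k" "m \<le> k" using k by auto
  define s where "s = (\<Oplus>i\<in>{..<m}. b i)"
  have s: "s \<in> carrier R" "s \<noteq> \<zero>" unfolding s_def using bc s0 by (auto intro: finsum_closed)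
  define c where "c = \<ominus> s"
  have c: "c \<in> carrier R" "c \<noteq> \<zero>" unfolding c_def using s by auto
  define C where "C = {x \<in> A m. c \<ominus> x \<in> A (Suc m)}"
  have cardC: "2 * (m * (M + m)) + 4 * (m * m) + (M + m) + 4 * m < card C"
    using cyclotomic_number_bound[OF c, of m "Suc m"] unfolding C_def card_carrier by (intro N)
  have Cc: "x \<in> carrier R" "x \<in> A m" "c \<ominus> x \<in> carrier R" "c \<ominus> x \<in> A (Suc m)" if "x \<in> C" for x
    using that c unfolding C_def by auto
  have refl_inj: "inj_on (\<lambda>x. c \<ominus> x) (carrier R)"
  proof (rule inj_onI)
    fix x x' assume x: "x \<in> carrier R" "x' \<in> carrier R" and e: "c \<ominus> x = c \<ominus> x'"
    have "x = c \<ominus> (c \<ominus> x)" using x c by algebra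
    also have "\<dots> = x'" unfolding e using x c by algebra
    finally show "x = x'" .
  qed
  \<comment> \<open>Conditions on \<open>y\<close> are counted in class \<open>Suc m\<close> and
    pulled back along the injective reflection \<open>\<lambda>x. c \<ominus> x\<close>.\<close>
  have refl_card: "card {x \<in> C. P (c \<ominus> x)} \<le> card {y \<in> A (Suc m). P y}" for P
  proof (rule card_inj_on_le)
    show "inj_on (\<lambda>x. c \<ominus> x) {x \<in> C. P (c \<ominus> x)}" using refl_inj Cc by (auto intro: inj_on_subset)
  qed (use Cc finite_class in auto)
  have finC: "finite C" unfolding C_def using finite_class by auto
  let ?T = "S \<union> ratios b m"
  \<comment> \<open>\<open>?B1\<close> to \<open>?B8\<close> are the failures of \<open>x1\<close>,
    \<open>x2\<close>, \<open>y1\<close>, \<open>y2\<close>, \<open>yx\<close>, \<open>xy\<close>,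
    \<open>xxy\<close>, \<open>yyx\<close> in \<open>good_block_final\<close>, in this
    order.\<close>
  let ?B1 = "\<Union>i\<in>{..<m}. {x \<in> C. x \<otimes> inv (b i) \<in> ?T}"
  let ?B2 = "\<Union>(i, j)\<in>{..<m} \<times> {..<m}. {x \<in> C. x \<otimes> x = b i \<otimes> b j}"
  let ?B3 = "\<Union>i\<in>{..<m}. {x \<in> C. (c \<ominus> x) \<otimes> inv (b i) \<in> ?T}"
  let ?B4 = "\<Union>(i, j)\<in>{..<m} \<times> {..<m}. {x \<in> C. (c \<ominus> x) \<otimes> (c \<ominus> x) = b i \<otimes> b j}"
  let ?B5 = "{x \<in> C. (c \<ominus> x) \<otimes> inv x \<in> ?T}"
  let ?B6 = "\<Union>(i, j)\<in>{..<m} \<times> {..<m}. {x \<in> C. x \<otimes> (c \<ominus> x) = b i \<otimes> b j}"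
  let ?B7 = "\<Union>i\<in>{..<m}. {x \<in> C. x \<otimes> x = (c \<ominus> x) \<otimes> b i}"
  let ?B8 = "\<Union>i\<in>{..<m}. {x \<in> C. (c \<ominus> x) \<otimes> (c \<ominus> x) = x \<otimes> b i}"
  note forb = card_forbidden_le[OF b mk(3) SM]
  have c1: "card ?B1 \<le> m * (M + m)"
  proof (rule card_UN_lessThan_le)
    fix i assume i: "i < m"
    have "card {x \<in> C. x \<otimes> inv (b i) \<in> ?T} \<le> card {x \<in> A m. x \<otimes> inv (b i) \<in> ?T}"
      using Cc finite_class by (intro card_mono) auto
    also have "\<dots> \<le> M + m" using forb[OF _ _ b[OF i]] i mk by auto
    finally show "card {x \<in> C. x \<otimes> inv (b i) \<in> ?T} \<le> M + m" .
  qed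
  have c2: "card ?B2 \<le> m * m * 1"
  proof (rule card_UN_pairs_le)
    fix i j
    have "card {x \<in> C. x \<otimes> x = b i \<otimes> b j} \<le> card {x \<in> A m. x \<otimes> x = b i \<otimes> b j}"
      using Cc finite_class by (intro card_mono) auto
    also have "\<dots> \<le> 1" by (rule card_square_eq_le)
    finally show "card {x \<in> C. x \<otimes> x = b i \<otimes> b j} \<le> 1" .
  qed
  have c3: "card ?B3 \<le> m * (M + m)"
  proof (rule card_UN_lessThan_le)
    fix i assume i: "i < m"
    have "card {x \<in> C. (c \<ominus> x) \<otimes> inv (b i) \<in> ?T} \<le> card {y \<in> A (Suc m). y \<otimes> inv (b i) \<in> ?T}"
      by (rule refl_card)
    also have "\<dots> \<le> M + m" using forb[OF _ _ b[OF i]] i mk by auto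
    finally show "card {x \<in> C. (c \<ominus> x) \<otimes> inv (b i) \<in> ?T} \<le> M + m" .
  qed
  have c4: "card ?B4 \<le> m * m * 1"
  proof (rule card_UN_pairs_le)
    fix i j
    have "card {x \<in> C. (c \<ominus> x) \<otimes> (c \<ominus> x) = b i \<otimes> b j} \<le> card {y \<in> A (Suc m). y \<otimes> y = b i \<otimes> b j}"
      by (rule refl_card)
    also have "\<dots> \<le> 1" by (rule card_square_eq_le)
    finally show "card {x \<in> C. (c \<ominus> x) \<otimes> (c \<ominus> x) = b i \<otimes> b j} \<le> 1" .
  qed
  \<comment> \<open>The quotient is c / x - 1, hence injective in \<open>x\<close>, and it lies in
    class (m + 1) - m = 1.\<close>
  have c5: "card ?B5 \<le> M + m"
  proof -
    have "card ?B5 \<le> card (?T \<inter> A 1)"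
    proof (rule card_inj_on_le)
      show "inj_on (\<lambda>x. (c \<ominus> x) \<otimes> inv x) ?B5"
      proof (rule inj_onI)
        fix x x' assume "x \<in> ?B5" "x' \<in> ?B5" and e: "(c \<ominus> x) \<otimes> inv x = (c \<ominus> x') \<otimes> inv x'"
        then have x: "x \<in> C" and x': "x' \<in> C" by auto
        have "(c \<ominus> x) \<otimes> x' = (c \<ominus> x') \<otimes> x"
          using e div_eq_iff[of "c \<ominus> x" x "c \<ominus> x'" x'] Cc[OF x] Cc[OF x'] class_unit by blast
        moreover have "c \<otimes> x' = (c \<ominus> x) \<otimes> x' \<oplus> x \<otimes> x'" using c Cc[OF x] Cc[OF x'] by algebra
        moreover have "c \<otimes> x = (c \<ominus> x') \<otimes> x \<oplus> x \<otimes> x'" using c Cc[OF x] Cc[OF x'] by algebra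
        ultimately have "c \<otimes> x' = c \<otimes> x" by simp
        then show "x = x'" using c Cc[OF x] Cc[OF x'] by (subst (asm) m_lcancel) auto
      qed
      show "(\<lambda>x. (c \<ominus> x) \<otimes> inv x) ` ?B5 \<subseteq> ?T \<inter> A 1"
      proof -
        have "(c \<ominus> x) \<otimes> inv x \<in> A 1" if x: "x \<in> C" for x
          using class_div[of "c \<ominus> x" 1 m x] Cc[OF x] by simp
        then show ?thesis by blast
      qed
    qed (use finite_class in auto)
    also have "\<dots> \<le> M + m"
    proof -
      have "\<not> [1 = 0] (mod k)" using k_ge by (simp add: cong_def)
      then show ?thesis
        using SM[of 1] card_ratios_class[OF b mk(3), of 1] card_Un_le[of "S \<inter> A 1" "ratios b m \<inter> A 1"]
        by (simp add: Int_Un_distrib2)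
    qed
    finally show ?thesis .
  qed
  \<comment> \<open>In this and the next two bounds, substituting \<open>c \<ominus> x\<close> for
    \<open>y\<close> gives a monic quadratic equation for \<open>x\<close>.\<close>
  have c6: "card ?B6 \<le> m * m * 2"
  proof (rule card_UN_pairs_le)
    fix i j assume ij: "i < m" "j < m"
    have "{x \<in> C. x \<otimes> (c \<ominus> x) = b i \<otimes> b j} \<subseteq> {x \<in> carrier R. x \<otimes> x = c \<otimes> x \<oplus> \<ominus> (b i \<otimes> b j)}"
    proof clarsimp
      fix x assume x: "x \<in> C" and e: "x \<otimes> (c \<ominus> x) = b i \<otimes> b j"
      have "x \<otimes> x = c \<otimes> x \<oplus> \<ominus> (x \<otimes> (c \<ominus> x))" using c Cc[OF x] by algebra
      then show "x \<in> carrier R \<and> x \<otimes> x = c \<otimes> x \<oplus> \<ominus> (b i \<otimes> b j)" using e Cc[OF x] by simp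
    qed
    then have "card {x \<in> C. x \<otimes> (c \<ominus> x) = b i \<otimes> b j} \<le> card {x \<in> carrier R. x \<otimes> x = c \<otimes> x \<oplus> \<ominus> (b i \<otimes> b j)}"
      using finite_carrier by (intro card_mono) auto
    also have "\<dots> \<le> 2" using c bc ij by (intro card_quadratic_le) auto
    finally show "card {x \<in> C. x \<otimes> (c \<ominus> x) = b i \<otimes> b j} \<le> 2" .
  qed
  have c7: "card ?B7 \<le> m * 2"
  proof (rule card_UN_lessThan_le)
    fix i assume i: "i < m"
    have "{x \<in> C. x \<otimes> x = (c \<ominus> x) \<otimes> b i} \<subseteq> {x \<in> carrier R. x \<otimes> x = (\<ominus> b i) \<otimes> x \<oplus> c \<otimes> b i}"
    proof clarsimp
      fix x assume x: "x \<in> C" and e: "x \<otimes> x = (c \<ominus> x) \<otimes> b i"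
      have "(c \<ominus> x) \<otimes> b i = (\<ominus> b i) \<otimes> x \<oplus> c \<otimes> b i" using c Cc[OF x] bc[OF i] by algebra
      then show "x \<in> carrier R \<and> (c \<ominus> x) \<otimes> b i = (\<ominus> b i) \<otimes> x \<oplus> c \<otimes> b i" using Cc[OF x] by simp
    qed
    then have "card {x \<in> C. x \<otimes> x = (c \<ominus> x) \<otimes> b i} \<le> card {x \<in> carrier R. x \<otimes> x = (\<ominus> b i) \<otimes> x \<oplus> c \<otimes> b i}"
      using finite_carrier by (intro card_mono) auto
    also have "\<dots> \<le> 2" using c bc i by (intro card_quadratic_le) auto
    finally show "card {x \<in> C. x \<otimes> x = (c \<ominus> x) \<otimes> b i} \<le> 2" .
  qed
  have c8: "card ?B8 \<le> m * 2"
  proof (rule card_UN_lessThan_le)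
    fix i assume i: "i < m"
    have "{x \<in> C. (c \<ominus> x) \<otimes> (c \<ominus> x) = x \<otimes> b i} \<subseteq>
      {x \<in> carrier R. x \<otimes> x = (b i \<oplus> c \<oplus> c) \<otimes> x \<oplus> \<ominus> (c \<otimes> c)}"
    proof clarsimp
      fix x assume x: "x \<in> C" and e: "(c \<ominus> x) \<otimes> (c \<ominus> x) = x \<otimes> b i"
      have "x \<otimes> x = (c \<ominus> x) \<otimes> (c \<ominus> x) \<oplus> (c \<oplus> c) \<otimes> x \<oplus> \<ominus> (c \<otimes> c)" using c Cc[OF x] by algebra
      also have "\<dots> = (b i \<oplus> c \<oplus> c) \<otimes> x \<oplus> \<ominus> (c \<otimes> c)" unfolding e using c Cc[OF x] bc[OF i] by algebra
      finally show "x \<in> carrier R \<and> x \<otimes> x = (b i \<oplus> c \<oplus> c) \<otimes> x \<oplus> \<ominus> (c \<otimes> c)" using Cc[OF x] by simp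
    qed
    then have "card {x \<in> C. (c \<ominus> x) \<otimes> (c \<ominus> x) = x \<otimes> b i} \<le>
        card {x \<in> carrier R. x \<otimes> x = (b i \<oplus> c \<oplus> c) \<otimes> x \<oplus> \<ominus> (c \<otimes> c)}"
      using finite_carrier by (intro card_mono) auto
    also have "\<dots> \<le> 2" using c bc i by (intro card_quadratic_le) auto
    finally show "card {x \<in> C. (c \<ominus> x) \<otimes> (c \<ominus> x) = x \<otimes> b i} \<le> 2" .
  qed
  let ?B = "?B1 \<union> ?B2 \<union> ?B3 \<union> ?B4 \<union> ?B5 \<union> ?B6 \<union> ?B7 \<union> ?B8"
  have "card ?B \<le> card ?B1 + card ?B2 + card ?B3 + card ?B4 + card ?B5 + card ?B6 + card ?B7 + card ?B8"
    by (intro order_trans[OF card_Un_le] add_mono order_refl)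
  also have "\<dots> \<le> 2 * (m * (M + m)) + 4 * (m * m) + (M + m) + 4 * m"
    using c1 c2 c3 c4 c5 c6 c7 c8 by simp
  also have "\<dots> < card C" by (rule cardC)
  finally have "card ?B < card C" .
  moreover have "finite ?B" using finC by auto
  ultimately obtain x where x: "x \<in> C" "x \<notin> ?B" by (rule card_less_obtain)
  define y where "y = c \<ominus> x"
  note xy = Cc[OF x(1), folded y_def]
  let ?b = "b(m := x, Suc m := y)"
  have "good_block S k ?b"
    using x xy by (intro good_block_final[OF g S k]) (auto simp: y_def)
  moreover have "(\<Oplus>i\<in>{..<k}. ?b i) = \<zero>"
  proof -
    have "(\<Oplus>i\<in>{..<k}. ?b i) = y \<oplus> (x \<oplus> (\<Oplus>i\<in>{..<m}. ?b i))"
      unfolding k using bc xy by (simp add: finsum_lessThan_Suc)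
    also have "(\<Oplus>i\<in>{..<m}. ?b i) = s" unfolding s_def using bc by (intro finsum_cong') auto
    also have "y \<oplus> (x \<oplus> s) = \<zero>" unfolding y_def c_def using s xy by algebra
    finally show ?thesis .
  qed
  ultimately show ?thesis by blast
qed

end

subsection \<open>Orthogonal systems from a family of blocks\<close>

text \<open>\<open>MOHS\<close> asks for a group on natural numbers, while the field lives on
  another type. A finite carrier injects into the naturals, and the whole structure is transported
  along this injection.\<close>

lemma MOHS_of_finite_group:
  fixes G :: "('a, 'b) monoid_scheme"
  assumes G: "comm_group G" and card: "card (carrier G) = 2 * v + 1" "2 * v + 1 \<ge> 7"
    and V: "half_set G V"
    and H: "\<And>i. i < r \<Longrightarrow> heffter_system G v k V (H i)"
    and orth: "\<And>i j. i < r \<Longrightarrow> j < r \<Longrightarrow> i \<noteq> j \<Longrightarrow> orthogonal_systems (H i) (H j)"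
  shows "MOHS v k r"
proof -
  interpret G: comm_group G by (rule G)
  have "finite (carrier G)" using card by (metis card.infinite add_is_0 one_neq_zero)
  then obtain f :: "'a \<Rightarrow> nat" where f: "inj_on f (carrier G)"
    using finite_imp_inj_to_nat_seg by blast
  define G' where "G' = image_group f G"
  have carr: "carrier G' = f ` carrier G" and one: "\<one>\<^bsub>G'\<^esub> = f \<one>\<^bsub>G\<^esub>"
    unfolding G'_def by (simp_all add: image_group_carrier image_group_one)
  have iso: "f \<in> iso G G'" unfolding G'_def by (rule inj_imp_image_group_iso[OF f])
  have grp: "group G'" unfolding G'_def by (rule G.inj_imp_image_group_is_group[OF f])
  have G': "comm_group G'"
    using G.iso_imp_comm_group[of G'] iso grp by (auto simp: is_iso_def group.is_monoid)
  interpret G': comm_group G' by (rule G')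
  interpret f: group_hom G G' f
    using iso by unfold_locales (simp add: iso_def)
  have Vc: "V \<subseteq> carrier G" using V unfolding half_set_def by blast
  have Bc: "B \<subseteq> carrier G" if "i < r" "B \<in> H i" for i B
    using H[OF that(1)] that(2) Vc partition_onD1 unfolding heffter_system_def by blast
  have fin_B: "finite B" if "i < r" "B \<in> H i" for i B
    using Bc[OF that] \<open>finite (carrier G)\<close> finite_subset by blast
  have mem: "f x \<in> f ` B \<longleftrightarrow> x \<in> B" if "x \<in> carrier G" "B \<subseteq> carrier G" for x B
    using inj_on_image_mem_iff[OF f] that by blast
  have prod: "f (finprod G (\<lambda>x. x) B) = finprod G' (\<lambda>x. x) (f ` B)" if "finite B" "B \<subseteq> carrier G" for B
    using that
  proof (induction B)
    case (insert b B)
    have "finprod G (\<lambda>x. x) B \<in> carrier G" using insert by (intro G.finprod_closed) auto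
    then have "f (finprod G (\<lambda>x. x) (insert b B)) = f b \<otimes>\<^bsub>G'\<^esub> f (finprod G (\<lambda>x. x) B)"
      using insert by (subst G.finprod_insert) (auto simp: f.hom_mult)
    also have "\<dots> = finprod G' (\<lambda>x. x) (insert (f b) (f ` B))"
      using insert mem[of b B] by (subst G'.finprod_insert) (auto simp: carr)
    finally show ?case by simp
  qed simp
  have half: "half_set G' (f ` V)"
    unfolding half_set_def
  proof
    show "f ` V \<subseteq> carrier G' - {\<one>\<^bsub>G'\<^esub>}"
    proof -
      have "\<one>\<^bsub>G\<^esub> \<notin> V" using V unfolding half_set_def by blast
      then have "f \<one>\<^bsub>G\<^esub> \<notin> f ` V" using mem[OF G.one_closed Vc] by simp
      moreover have "f ` V \<subseteq> f ` carrier G" using Vc by (rule image_mono)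
      ultimately show ?thesis unfolding carr one by blast
    qed
    show "\<forall>g\<in>carrier G' - {\<one>\<^bsub>G'\<^esub>}. (g \<in> f ` V) \<noteq> (inv\<^bsub>G'\<^esub> g \<in> f ` V)"
    proof
      fix g assume "g \<in> carrier G' - {\<one>\<^bsub>G'\<^esub>}"
      then have g: "g \<in> f ` carrier G" "g \<noteq> f \<one>\<^bsub>G\<^esub>" unfolding carr one by auto
      then obtain x where x: "x \<in> carrier G" "g = f x" by blast
      with g have "x \<noteq> \<one>\<^bsub>G\<^esub>" by blast
      with x have 0: "(x \<in> V) \<noteq> (inv\<^bsub>G\<^esub> x \<in> V)" using V unfolding half_set_def by blast
      have 1: "f (inv\<^bsub>G\<^esub> x) = inv\<^bsub>G'\<^esub> g" using f.hom_inv[OF x(1)] x(2) by simp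
      show "(g \<in> f ` V) \<noteq> (inv\<^bsub>G'\<^esub> g \<in> f ` V)"
        using 0 mem[OF x(1) Vc] mem[OF G.inv_closed[OF x(1)] Vc] unfolding 1 x(2) by blast
    qed
  qed
  have heff: "heffter_system G' v k (f ` V) ((`) f ` H i)" if i: "i < r" for i
    unfolding heffter_system_def
  proof (intro conjI ballI)
    have h: "card V = v" "partition_on V (H i)" "\<And>B. B \<in> H i \<Longrightarrow> card B = k"
      "\<And>B. B \<in> H i \<Longrightarrow> finprod G (\<lambda>x. x) B = \<one>\<^bsub>G\<^esub>"
      using H[OF i] unfolding heffter_system_def by auto
    have injV: "inj_on f V" using inj_on_subset[OF f Vc] .
    show "card (f ` V) = v" using card_image[OF injV] h by simp
    show "partition_on (f ` V) ((`) f ` H i)"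
    proof (rule partition_onI)
      show "\<Union> ((`) f ` H i) = f ` V" using partition_onD1[OF h(2)] by auto
      show "{} \<notin> (`) f ` H i" using partition_onD3[OF h(2)] by auto
      fix P Q assume "P \<in> (`) f ` H i" "Q \<in> (`) f ` H i" "P \<noteq> Q"
      then obtain B C where BC: "B \<in> H i" "C \<in> H i" "P = f ` B" "Q = f ` C" "B \<noteq> C" by auto
      then have "B \<inter> C = {}" using partition_onD2[OF h(2)] unfolding disjoint_def by blast
      then have "f ` B \<inter> f ` C = {}"
        using inj_on_image_Int[OF f Bc[OF i BC(1)] Bc[OF i BC(2)]] by simp
      then show "disjnt P Q" using BC by (simp add: disjnt_def)
    qed
    fix P assume "P \<in> (`) f ` H i"
    then obtain B where B: "B \<in> H i" "P = f ` B" by auto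
    show "card P = k" using B h card_image[OF inj_on_subset[OF f Bc[OF i B(1)]]] by simp
    show "finprod G' (\<lambda>x. x) P = \<one>\<^bsub>G'\<^esub>"
      using prod[OF fin_B[OF i B(1)] Bc[OF i B(1)]] h(4)[OF B(1)] B(2) by simp
  qed
  have orth': "orthogonal_systems ((`) f ` H i) ((`) f ` H j)" if ij: "i < r" "j < r" "i \<noteq> j" for i j
    unfolding orthogonal_systems_def
  proof (intro ballI)
    fix P Q assume "P \<in> (`) f ` H i" "Q \<in> (`) f ` H j"
    then obtain B C where BC: "B \<in> H i" "C \<in> H j" "P = f ` B" "Q = f ` C" by auto
    have "P \<inter> Q = f ` (B \<inter> C)"
      using inj_on_image_Int[OF f Bc[OF ij(1) BC(1)] Bc[OF ij(2) BC(2)]] BC by simp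
    then have "card (P \<inter> Q) \<le> card (B \<inter> C)"
      using card_image_le[of "B \<inter> C" f] fin_B[OF ij(1) BC(1)] by simp
    also have "\<dots> \<le> 1" using orth[OF ij] BC unfolding orthogonal_systems_def by blast
    finally show "card (P \<inter> Q) \<le> 1" .
  qed
  have "card (carrier G') = 2 * v + 1" unfolding carr using card card_image[OF f] by simp
  then show ?thesis
    unfolding MOHS_def using G' half heff orth' card(2)
    by (intro exI[of _ G'] exI[of _ "f ` V"] exI[of _ "\<lambda>i. (`) f ` H i"] conjI allI impI)
qed

section \<open>Block families and their multiplicative translates\<close>

context cyclotomic_classes
begin

definition block_family :: "nat \<Rightarrow> (nat \<Rightarrow> nat \<Rightarrow> 'a) \<Rightarrow> bool" where
  "block_family n b \<longleftrightarrow> (\<forall>m<n. (\<forall>i<k. b m i \<in> A i) \<and> (\<Oplus>i\<in>{..<k}. b m i) = \<zero>) \<and>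
     inj_on (\<lambda>(m, i, j). ratio (b m) i j) {(m, i, j). m < n \<and> i < k \<and> j < k \<and> i \<noteq> j}"

text \<open>\<open>S\<close> collects the ratios of the blocks found so far. Each block puts at most
  k of them into a class, and at most n - 1 blocks precede the one being built; hence M = (n - 1)
  k.\<close>

lemma block_family_exists:
  assumes k: "k = Suc (Suc m)" and M: "M + k = n * k"
    and t: "k * (M + k) + k * k + 1 < t"
    and N: "\<And>N. ((real t)\<^sup>2 / real (2 * k * t + 1) - real N)\<^sup>2 \<le> real (2 * k * t + 1) - real t \<Longrightarrow>
      2 * (m * (M + m)) + 4 * (m * m) + (M + m) + 4 * m < N"
  shows "l \<le> n \<Longrightarrow> \<exists>b. block_family l b"
proof (induction l)
  case 0
  show ?case by (intro exI[of _ "\<lambda>_ _. \<zero>"]) (simp add: block_family_def inj_on_def)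
next
  case (Suc l)
  then obtain b where b: "block_family l b" by auto
  have bA: "\<And>m i. m < l \<Longrightarrow> i < k \<Longrightarrow> b m i \<in> A i" using b unfolding block_family_def by blast
  define S where "S = (\<Union>m\<in>{..<l}. ratios (b m) k)"
  have Sinv: "inv s \<in> S" if "s \<in> S" for s
    using that ratios_inv[of k "b _"] bA unfolding S_def by blast
  have SM: "card (S \<inter> A d) \<le> M" for d
  proof -
    have "card (S \<inter> A d) \<le> card (\<Union>m\<in>{..<l}. ratios (b m) k \<inter> A d)"
      unfolding S_def using finite_class by (intro card_mono) auto
    also have "\<dots> \<le> l * k"
      using card_ratios_class[of k "b _"] bA by (intro card_UN_lessThan_le) auto
    also have "\<dots> \<le> M"
    proof -
      have "Suc l * k \<le> n * k" using Suc.prems by (intro mult_right_mono) auto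
      then show ?thesis using M by simp
    qed
    finally show ?thesis .
  qed
  obtain x where x: "good_block S k x" and x0: "(\<Oplus>i\<in>{..<k}. x i) = \<zero>"
    using block_exists[OF Sinv SM t k N] by blast
  have xA: "\<And>i. i < k \<Longrightarrow> x i \<in> A i" and xS: "ratios x k \<inter> S = {}"
    and xinj: "inj_on (\<lambda>(i, j). ratio x i j) {(i, j). i < k \<and> j < k \<and> i \<noteq> j}"
    using x unfolding good_block_def by auto
  let ?b = "b(l := x)"
  have disj: "ratio x i j \<noteq> ratio (b m') i' j'"
    if "i < k" "j < k" "i \<noteq> j" "m' < l" "i' < k" "j' < k" "i' \<noteq> j'" for i j m' i' j'
  proof -
    have "ratio x i j \<in> ratios x k" "ratio (b m') i' j' \<in> S"
      using that unfolding ratios_def S_def by blast+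
    then show ?thesis using xS by auto
  qed
  have "inj_on (\<lambda>(m, i, j). ratio (?b m) i j) {(m, i, j). m < Suc l \<and> i < k \<and> j < k \<and> i \<noteq> j}"
    (is "inj_on ?f ?X")
  proof (rule inj_onI)
    fix p p' assume p: "p \<in> ?X" "p' \<in> ?X" "?f p = ?f p'"
    obtain m i j m' i' j' where pp: "p = (m, i, j)" "p' = (m', i', j')" by (metis prod_cases3)
    then have h: "m < Suc l" "i < k" "j < k" "i \<noteq> j" "m' < Suc l" "i' < k" "j' < k" "i' \<noteq> j'"
      and e: "ratio (?b m) i j = ratio (?b m') i' j'" using p by auto
    consider "m = l" "m' = l" | "m = l" "m' < l" | "m < l" "m' = l" | "m < l" "m' < l" using h by linarith
    then have "m = m' \<and> i = i' \<and> j = j'"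
    proof cases
      case 1 then show ?thesis using e h inj_onD[OF xinj, of "(i, j)" "(i', j')"] by simp
    next
      case 2 then show ?thesis using e h disj[of i j m' i' j'] by simp
    next
      case 3 then show ?thesis using e h disj[of i' j' m i j] by simp
    next
      case 4
      have "inj_on (\<lambda>(m, i, j). ratio (b m) i j) {(m, i, j). m < l \<and> i < k \<and> j < k \<and> i \<noteq> j}"
        using b unfolding block_family_def by blast
      from inj_onD[OF this, of "(m, i, j)" "(m', i', j')"] show ?thesis using 4 e h by simp
    qed
    then show "p = p'" using pp by simp
  qed
  moreover have "\<forall>m<Suc l. (\<forall>i<k. ?b m i \<in> A i) \<and> (\<Oplus>i\<in>{..<k}. ?b m i) = \<zero>"
    using b xA x0 unfolding block_family_def by (auto simp: less_Suc_eq)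
  ultimately show ?case unfolding block_family_def by blast
qed

definition translates :: "(nat \<Rightarrow> 'a) \<Rightarrow> nat \<Rightarrow> 'a set set" where
  "translates b j = (\<lambda>u. (\<lambda>i. u \<otimes> b i) ` {..<k}) ` A j"

lemma half_set_classes: "half_set (add_monoid R) (\<Union>i. A i)"
proof -
  have "(x \<in> (\<Union>i. A i)) \<noteq> (\<ominus> x \<in> (\<Union>i. A i))" if "x \<in> carrier R - {\<zero>}" for x
    using that class_cover[OF that] class_add_nonzero[of x _ "\<ominus> x"] r_neg[of x] by blast
  then show ?thesis unfolding half_set_def using class_sub by (auto simp: a_inv_def[symmetric])
qed

lemma card_classes: "card (\<Union>i. A i) = k * t"
proof -
  have "(\<Union>i. A i) = (\<Union>i\<in>{..<k}. A i)"
  proof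
    show "(\<Union>i. A i) \<subseteq> (\<Union>i\<in>{..<k}. A i)"
    proof
      fix x assume "x \<in> (\<Union>i. A i)"
      then obtain i where "x \<in> A i" by blast
      then have "x \<in> A (i mod k)" using class_cong[of i "i mod k"] by (simp add: cong_def)
      then show "x \<in> (\<Union>i\<in>{..<k}. A i)" using k_ge by auto
    qed
  qed auto
  moreover have "card (\<Union>i\<in>{..<k}. A i) = (\<Sum>i\<in>{..<k}. card (A i))"
    using finite_class class_neq by (intro card_UN_disjoint) blast+
  ultimately show ?thesis by (simp add: card_class)
qed

text \<open>The product \<open>u \<otimes> b i\<close> lies in class \<open>j + i\<close>, so it
  reveals \<open>i\<close> modulo \<open>k\<close>, and then \<open>u\<close> by
  cancellation.\<close>

lemma translate_eqD:
  assumes b: "\<And>i. i < k \<Longrightarrow> b i \<in> A i" and u: "u \<in> A j" "u' \<in> A j"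
    and i: "i < k" "i' < k" and e: "u \<otimes> b i = u' \<otimes> b i'"
  shows "u = u'" "i = i'"
proof -
  have "[j + i = j + i'] (mod k)"
    using class_mult[OF u(1) b[OF i(1)]] class_mult[OF u(2) b[OF i(2)]] e class_unique by metis
  then show "i = i'" using i cong_add_lcancel_nat cong_less_modulus_unique_nat by blast
  then have "u \<otimes> b i = u' \<otimes> b i" using e by simp
  then show "u = u'" using u b[OF i(1)] class_sub by (subst (asm) m_rcancel) auto
qed

lemma heffter_system_translates:
  assumes b: "\<And>i. i < k \<Longrightarrow> b i \<in> A i" and b0: "(\<Oplus>i\<in>{..<k}. b i) = \<zero>"
  shows "heffter_system (add_monoid R) (k * t) k (\<Union>i. A i) (translates b j)"
  unfolding heffter_system_def
proof (intro conjI ballI)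
  show "card (\<Union>i. A i) = k * t" by (rule card_classes)
  show "partition_on (\<Union>i. A i) (translates b j)"
  proof (rule partition_onI)
    show "{} \<notin> translates b j" using k_ge unfolding translates_def by (auto simp: lessThan_empty_iff)
    show "\<Union> (translates b j) = (\<Union>i. A i)"
    proof
      show "\<Union> (translates b j) \<subseteq> (\<Union>i. A i)"
        unfolding translates_def using class_mult b by fastforce
      show "(\<Union>i. A i) \<subseteq> \<Union> (translates b j)"
      proof
        fix x assume "x \<in> (\<Union>i. A i)"
        then obtain l where x: "x \<in> A l" by blast
        \<comment> \<open>This is l - j modulo \<open>k\<close>, the position for which
          \<open>x \<otimes> inv (b i)\<close> falls into \<open>A j\<close>.\<close>
        define i where "i = (l + (k - 1) * j) mod k"
        have i: "i < k" unfolding i_def using k_ge by simp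
        have "[j + i = j + (l + (k - 1) * j)] (mod k)"
          unfolding i_def by (intro cong_add) (auto simp: cong_def)
        also have e: "j + (l + (k - 1) * j) = l + k * j" using k_ge by (cases k) auto
        also have "[l + k * j = l] (mod k)" by (simp add: cong_def)
        finally have "A l = A (j + i)" using class_cong by blast
        then have u: "x \<otimes> inv (b i) \<in> A j" using class_div[of x j i "b i"] x b[OF i] by simp
        have "x = x \<otimes> inv (b i) \<otimes> b i" using x b[OF i] class_unit by (simp add: m_assoc)
        then show "x \<in> \<Union> (translates b j)" unfolding translates_def using u i by blast
      qed
    qed
    fix P Q assume "P \<in> translates b j" "Q \<in> translates b j" "P \<noteq> Q"
    then obtain u u' where u: "u \<in> A j" "u' \<in> A j" "u \<noteq> u'"
      and PQ: "P = (\<lambda>i. u \<otimes> b i) ` {..<k}" "Q = (\<lambda>i. u' \<otimes> b i) ` {..<k}"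
      unfolding translates_def by auto
    show "disjnt P Q" unfolding PQ disjnt_def using translate_eqD(1)[OF b u(1,2)] u(3) by blast
  qed
  fix P assume "P \<in> translates b j"
  then obtain u where u: "u \<in> A j" and P: "P = (\<lambda>i. u \<otimes> b i) ` {..<k}" unfolding translates_def by auto
  have inj: "inj_on (\<lambda>i. u \<otimes> b i) {..<k}" using translate_eqD(2)[OF b u u] by (intro inj_onI) auto
  show "card P = k" unfolding P by (simp add: card_image[OF inj])
  have "finprod (add_monoid R) (\<lambda>x. x) P = (\<Oplus>x\<in>P. x)" by (simp add: finsum_def)
  also have "\<dots> = (\<Oplus>i\<in>{..<k}. u \<otimes> b i)" unfolding P
    using u b inj by (subst add.finprod_reindex) auto
  also have "\<dots> = u \<otimes> (\<Oplus>i\<in>{..<k}. b i)" using u b by (subst finsum_rdistr) auto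
  finally show "finprod (add_monoid R) (\<lambda>x. x) P = \<one>\<^bsub>add_monoid R\<^esub>" using b0 u by simp
qed

text \<open>Two points common to two blocks give equal ratios, and these determine
  the base block and the two positions, hence also the multiplier.\<close>

lemma orthogonal_translates:
  assumes b: "block_family n b" and m: "m < n" "m' < n" and j: "j < k" "j' < k" and ne: "(m, j) \<noteq> (m', j')"
  shows "orthogonal_systems (translates (b m) j) (translates (b m') j')"
  unfolding orthogonal_systems_def
proof (intro ballI)
  fix P Q assume "P \<in> translates (b m) j" "Q \<in> translates (b m') j'"
  then obtain u u' where u: "u \<in> A j" "u' \<in> A j'"
    and PQ: "P = (\<lambda>i. u \<otimes> b m i) ` {..<k}" "Q = (\<lambda>i. u' \<otimes> b m' i) ` {..<k}"
    unfolding translates_def by auto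
  have bA: "\<And>m i. m < n \<Longrightarrow> i < k \<Longrightarrow> b m i \<in> A i" using b unfolding block_family_def by blast
  have "x = y" if x: "x \<in> P \<inter> Q" and y: "y \<in> P \<inter> Q" for x y
  proof (rule ccontr)
    assume xy: "x \<noteq> y"
    obtain i i' where i: "i < k" "i' < k" "x = u \<otimes> b m i" "x = u' \<otimes> b m' i'" using x unfolding PQ by auto
    obtain l l' where l: "l < k" "l' < k" "y = u \<otimes> b m l" "y = u' \<otimes> b m' l'" using y unfolding PQ by auto
    have ne': "i \<noteq> l" "i' \<noteq> l'" using xy i l by auto
    have cancel: "(w \<otimes> c) \<otimes> inv (w \<otimes> d) = c \<otimes> inv d"
      if "w \<in> Units R" "c \<in> Units R" "d \<in> Units R" for w c d
    proof -
      have "w \<otimes> d \<in> Units R" using that by simp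
      moreover have "w \<otimes> c \<otimes> d = c \<otimes> (w \<otimes> d)" using that Units_closed by (simp add: m_ac)
      ultimately show ?thesis using that by (subst div_eq_iff) auto
    qed
    note U = class_unit[OF u(1)] class_unit[OF u(2)] class_unit[OF bA]
    have "ratio (b m) i l = x \<otimes> inv y"
      unfolding ratio_def i(3) l(3) by (rule cancel[symmetric]) (use U m i l in auto)
    also have "\<dots> = ratio (b m') i' l'"
      unfolding ratio_def i(4) l(4) by (rule cancel) (use U m i l in auto)
    finally have e: "ratio (b m) i l = ratio (b m') i' l'" .
    have "inj_on (\<lambda>(m, i, j). ratio (b m) i j) {(m, i, j). m < n \<and> i < k \<and> j < k \<and> i \<noteq> j}"
      using b unfolding block_family_def by blast
    from inj_onD[OF this, of "(m, i, l)" "(m', i', l')"] have "(m, i, l) = (m', i', l')"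
      using e m i l ne' by simp
    then have eq: "m = m'" "i = i'" by auto
    have "u \<otimes> b m i = u' \<otimes> b m i" using i(3,4) unfolding eq by simp
    then have "u = u'" using u bA[OF m(1) i(1)] class_sub by (subst (asm) m_rcancel) auto
    then have "[j = j'] (mod k)" using class_unique[of u j j'] u by simp
    then have "j = j'" using j cong_less_modulus_unique_nat by blast
    then show False using ne eq by simp
  qed
  moreover have "finite (P \<inter> Q)" unfolding PQ by simp
  ultimately show "card (P \<inter> Q) \<le> 1" by (subst One_nat_def, subst card_le_Suc0_iff_eq) auto
qed

lemma MOHS_of_block_family:
  assumes b: "block_family n b" and r: "r \<le> n * k"
  shows "MOHS (k * t) k r"
proof (rule MOHS_of_finite_group)
  show "comm_group (add_monoid R)" by (rule a_comm_group)
  show "card (carrier (add_monoid R)) = 2 * (k * t) + 1" using card_carrier by simp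
  have "3 * 1 \<le> k * t" using k_ge t_pos by (intro mult_mono) auto
  then show "7 \<le> 2 * (k * t) + 1" by simp
  show "half_set (add_monoid R) (\<Union>i. A i)" by (rule half_set_classes)
  have k0: "0 < k" using k_ge by simp
  \<comment> \<open>System number \<open>i\<close> uses block \<open>i div k\<close> and the
    multipliers in class \<open>i mod k\<close>.\<close>
  have div: "i div k < n" if "i < r" for i
    using that r by (intro less_mult_imp_div_less) simp
  show "heffter_system (add_monoid R) (k * t) k (\<Union>i. A i) (translates (b (i div k)) (i mod k))" if "i < r" for i
    using b div[OF that] unfolding block_family_def by (intro heffter_system_translates) auto
  show "orthogonal_systems (translates (b (i div k)) (i mod k)) (translates (b (j div k)) (j mod k))"
    if "i < r" "j < r" "i \<noteq> j" for i j
  proof (rule orthogonal_translates[OF b div div])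
    show "(i div k, i mod k) \<noteq> (j div k, j mod k)"
      using that(3) by (metis Pair_inject div_mult_mod_eq)
  qed (use that k0 in auto)
qed

end

subsection \<open>Existence of cyclotomic classes and the numerical estimate\<close>

lemma (in field) exists_primitive_element:
  assumes fin: "finite (carrier R)" and card: "card (carrier R) = N + 1"
  obtains g where "g \<in> carrier R" "\<And>i j::nat. g [^] i = g [^] j \<longleftrightarrow> [i = j] (mod N)"
    "\<And>x. x \<in> carrier R - {\<zero>} \<Longrightarrow> \<exists>i::nat. x = g [^] i"
proof -
  obtain g where g: "g \<in> carrier (Multiplicative_Group.mult_of R)" "carrier (Multiplicative_Group.mult_of R) = {g [^] i | i::nat. i \<in> UNIV}"
    using finite_field_mult_group_has_gen[OF fin] by (rule bexE)
  have gR: "g \<in> carrier R" using g by simp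
  interpret G: group "Multiplicative_Group.mult_of R" by (rule field_mult_group)
  have cardG: "card (carrier R - {\<zero>}) = N" using fin card by simp
  then have ord: "order (Multiplicative_Group.mult_of R) = N" by (simp add: order_def)
  have N0: "N > 0"
  proof -
    have "\<one> \<in> carrier R - {\<zero>}" by simp
    then show ?thesis using cardG fin by (metis card_gt_0_iff empty_iff finite_Diff)
  qed
  have gN: "g [^] N = \<one>" using G.pow_order_eq_1[OF g(1)] ord by (simp add: Multiplicative_Group.nat_pow_mult_of)
  have gmod: "g [^] i = g [^] (i mod N)" for i :: nat
  proof -
    have "g [^] i = g [^] (N * (i div N) + i mod N)" by simp
    also have "\<dots> = (g [^] N) [^] (i div N) \<otimes> g [^] (i mod N)"
      using gR by (simp only: nat_pow_mult nat_pow_pow)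
    also have "\<dots> = g [^] (i mod N)" using gR gN by simp
    finally show ?thesis .
  qed
  have img: "(\<lambda>i. g [^] i) ` {..<N} = carrier R - {\<zero>}"
  proof -
    have "carrier R - {\<zero>} = range (\<lambda>i::nat. g [^] i)" using g(2) by auto
    also have "\<dots> = (\<lambda>i. g [^] i) ` {..<N}"
    proof
      show "range (\<lambda>i::nat. g [^] i) \<subseteq> (\<lambda>i. g [^] i) ` {..<N}"
      proof (rule image_subsetI)
        fix i
        have "g [^] (i mod N) \<in> (\<lambda>i. g [^] i) ` {..<N}" using N0 by (intro imageI) simp
        then show "g [^] i \<in> (\<lambda>i. g [^] i) ` {..<N}" by (simp only: gmod[of i])
      qed
    qed auto
    finally show ?thesis ..
  qed
  then have inj: "inj_on (\<lambda>i. g [^] i) {..<N}"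
    using cardG by (intro eq_card_imp_inj_on) auto
  have eq: "g [^] i = g [^] j \<longleftrightarrow> [i = j] (mod N)" for i j :: nat
    using gmod[of i] gmod[of j] inj_onD[OF inj, of "i mod N" "j mod N"] N0 unfolding cong_def by auto
  show ?thesis
  proof (rule that[OF gR eq])
    fix x assume "x \<in> carrier R - {\<zero>}"
    then show "\<exists>i::nat. x = g [^] i" using img by blast
  qed
qed

lemma cong_double_iff: "[2 * a = 2 * b] (mod 2 * n) \<longleftrightarrow> [a = b] (mod (n::nat))"
  by (simp add: cong_def)

text \<open>Squares are the even powers of a primitive element, sorted by half the exponent modulo
  \<open>k\<close>. Exponents count modulo the even number \<open>2 * (k * t)\<close>, so their
  parity is well defined; negation adds the odd number \<open>k * t\<close> and flips it. Hence
  exactly one of x and -x has an even exponent, which gives the last two locale conditions.\<close>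

lemma (in field) exists_cyclotomic_classes:
  assumes fin: "finite (carrier R)" and card: "card (carrier R) = 2 * k * t + 1"
    and k: "odd k" "k \<ge> 3" and t: "odd t"
  shows "\<exists>A. cyclotomic_classes R k t A"
proof -
  have card': "card (carrier R) = 2 * (k * t) + 1" using card by simp
  obtain g where gR: "g \<in> carrier R"
    and eq: "\<And>i j::nat. g [^] i = g [^] j \<longleftrightarrow> [i = j] (mod 2 * (k * t))"
    and gen: "\<And>x. x \<in> carrier R - {\<zero>} \<Longrightarrow> \<exists>i::nat. x = g [^] i"
    using exists_primitive_element[OF fin card'] by metis
  have t0: "t > 0" and kt0: "k * t > 0" using t k by (auto intro: odd_pos)
  have g0: "g [^] i \<noteq> \<zero>" for i :: nat
  proof
    assume "g [^] i = \<zero>"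
    then have "g [^] (i + 1) = \<zero>" using gR by simp
    then have "[i = i + 1] (mod 2 * (k * t))" using \<open>g [^] i = \<zero>\<close> eq by metis
    then have "[i + 0 = i + 1] (mod 2 * (k * t))" by simp
    then have "[0 = 1] (mod 2 * (k * t))" by (simp only: cong_add_lcancel_nat)
    then show False using kt0 by (simp add: cong_def)
  qed
  have mul: "g [^] i \<otimes> g [^] j = g [^] (i + j)" for i j :: nat using gR by (rule nat_pow_mult)
  have neg1: "g [^] (k * t) = \<ominus> \<one>"
  proof -
    let ?h = "g [^] (k * t)"
    have h: "?h \<in> carrier R" using gR by simp
    have "?h \<otimes> ?h = g [^] (0::nat)" unfolding mul eq by (simp add: cong_def mult_2[symmetric])
    then have "(?h \<ominus> \<one>) \<otimes> (?h \<oplus> \<one>) = \<zero>"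
    proof -
      have "(?h \<ominus> \<one>) \<otimes> (?h \<oplus> \<one>) = ?h \<otimes> ?h \<ominus> \<one>" using h by algebra
      then show ?thesis using \<open>?h \<otimes> ?h = g [^] (0::nat)\<close> by simp
    qed
    moreover have "?h \<noteq> g [^] (0::nat)" unfolding eq using kt0 by (simp add: cong_def)
    then have "?h \<ominus> \<one> \<noteq> \<zero>" using h by simp
    ultimately have "?h \<oplus> \<one> = \<zero>" using h integral by blast
    then show ?thesis using h minus_equality[of ?h \<one>] by simp
  qed
  have neg: "\<ominus> (g [^] i) = g [^] (k * t + i)" for i :: nat
    unfolding mul[symmetric] neg1 using gR by (simp add: l_minus)
  define A where "A i = {g [^] (2 * j) | j. [j = i] (mod k)}" for i
  have "cyclotomic_classes R k t A"
  proof (unfold_locales)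
    show "finite (carrier R)" "card (carrier R) = 2 * k * t + 1" "3 \<le> k" "0 < t"
      using fin card k t0 by auto
    show "A i \<subseteq> carrier R - {\<zero>}" for i unfolding A_def using gR g0 by auto
    show "x \<otimes> y \<in> A (i + j)" if xy: "x \<in> A i" "y \<in> A j" for x y i j
    proof -
      obtain a b where a: "x = g [^] (2 * a)" "[a = i] (mod k)" and b: "y = g [^] (2 * b)" "[b = j] (mod k)"
        using xy unfolding A_def by auto
      have "x \<otimes> y = g [^] (2 * (a + b))" unfolding a b mul by (simp add: algebra_simps)
      then show ?thesis unfolding A_def using cong_add[OF a(2) b(2)] by blast
    qed
    show "x \<otimes> inv y \<in> A i" if xy: "x \<in> A (i + j)" "y \<in> A j" for x y i j
    proof -
      obtain a b where a: "x = g [^] (2 * a)" "[a = i + j] (mod k)" and b: "y = g [^] (2 * b)" "[b = j] (mod k)"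
        using xy unfolding A_def by auto
      \<comment> \<open>Half exponents count modulo \<open>k * t\<close>, where
        \<open>(k * t - 1) * b\<close> stands for -b.\<close>
      let ?c = "a + (k * t - 1) * b"
      have cb: "?c + b = a + k * t * b" using kt0 by (cases "k * t") auto
      have "g [^] (2 * ?c) \<otimes> y = g [^] (2 * ?c + 2 * b)" unfolding b mul ..
      also have "2 * ?c + 2 * b = 2 * (a + k * t * b)" unfolding cb[symmetric] by simp
      also have "g [^] (2 * (a + k * t * b)) = x" unfolding a eq cong_double_iff by (simp add: cong_def)
      finally have "x = g [^] (2 * ?c) \<otimes> y" ..
      moreover have "y \<in> Units R" unfolding b using g0 gR field_Units by auto
      ultimately have "x \<otimes> inv y = g [^] (2 * ?c)" using gR by (simp add: m_assoc Units_closed)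
      moreover have "[?c = i] (mod k)"
      proof -
        have "[?c + b = a] (mod k)" unfolding cb by (simp add: cong_def mult.assoc)
        also have "[a = i + j] (mod k)" by (rule a)
        also have "[i + j = i + b] (mod k)" using b by (simp add: cong_add_lcancel_nat cong_sym)
        finally show ?thesis by (simp only: cong_add_rcancel_nat)
      qed
      ultimately show ?thesis unfolding A_def by blast
    qed
    show "[i = j] (mod k)" if xy: "x \<in> A i" "x \<in> A j" for x i j
    proof -
      obtain a b where a: "x = g [^] (2 * a)" "[a = i] (mod k)" and b: "x = g [^] (2 * b)" "[b = j] (mod k)"
        using xy unfolding A_def mem_Collect_eq by blast
      have "[a = b] (mod k * t)" using a b eq cong_double_iff by metis
      then have "[a = b] (mod k)" by (rule cong_modulus_mult_nat)
      then show ?thesis using a b cong_trans cong_sym by metis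
    qed
    show "A i = A j" if "[i = j] (mod k)" for i j
      unfolding A_def using that cong_trans cong_sym by metis
    show "card (A i) = t" for i
    proof -
      have "A i = (\<lambda>m. g [^] (2 * (i + k * m))) ` {..<t}"
      proof
        show "(\<lambda>m. g [^] (2 * (i + k * m))) ` {..<t} \<subseteq> A i"
        proof (rule image_subsetI)
          fix m
          have "[i + k * m = i] (mod k)" by (simp add: cong_def)
          then show "g [^] (2 * (i + k * m)) \<in> A i" unfolding A_def by blast
        qed
        show "A i \<subseteq> (\<lambda>m. g [^] (2 * (i + k * m))) ` {..<t}"
        proof
          fix x assume "x \<in> A i"
          then obtain j where x: "x = g [^] (2 * j)" and j: "[j = i] (mod k)" unfolding A_def by auto
          \<comment> \<open>Adding a multiple of \<open>k * t\<close> keeps the power unchanged and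
            makes the subtraction of \<open>i\<close> possible among natural numbers.\<close>
          have le: "i \<le> j + k * t * i" using kt0 by (cases "k * t") auto
          have "[j + k * t * i = i] (mod k)" using j by (simp add: cong_def mult.assoc)
          then have "k dvd j + k * t * i - i" using le by (simp add: cong_altdef_nat)
          then obtain d where "j + k * t * i - i = k * d" by (elim dvdE)
          then have d: "j + k * t * i = i + k * d" using le by simp
          have "[j = j + k * t * i] (mod k * t)" by (simp add: cong_def)
          also have "[k * d = k * (d mod t)] (mod k * t)" by (simp add: cong_def)
          then have "[j + k * t * i = i + k * (d mod t)] (mod k * t)"
            unfolding d by (simp add: cong_add_lcancel_nat)
          finally have "x = g [^] (2 * (i + k * (d mod t)))" unfolding x eq cong_double_iff .
          then show "x \<in> (\<lambda>m. g [^] (2 * (i + k * m))) ` {..<t}" using t0 by auto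
        qed
      qed
      moreover have "inj_on (\<lambda>m. g [^] (2 * (i + k * m))) {..<t}"
      proof (rule inj_onI)
        fix m m' assume m: "m \<in> {..<t}" "m' \<in> {..<t}" and "g [^] (2 * (i + k * m)) = g [^] (2 * (i + k * m'))"
        then have "[i + k * m = i + k * m'] (mod k * t)" unfolding eq cong_double_iff by simp
        then have "[k * m = k * m'] (mod k * t)" by (simp only: cong_add_lcancel_nat)
        then show "m = m'" using m k by (simp add: cong_def)
      qed
      ultimately show ?thesis by (simp add: card_image)
    qed
    show "x \<oplus> y \<noteq> \<zero>" if xy: "x \<in> A i" "y \<in> A j" for x y i j
    proof
      assume "x \<oplus> y = \<zero>"
      obtain a b :: nat where a: "x = g [^] (2 * a)" and b: "y = g [^] (2 * b)"
        using xy unfolding A_def by auto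
      have "x = \<ominus> y" using \<open>x \<oplus> y = \<zero>\<close> minus_equality[of x y] a b gR by simp
      then have "[2 * a = k * t + 2 * b] (mod 2 * (k * t))" unfolding a b neg eq .
      then have "[2 * a = k * t + 2 * b] (mod 2)" by (rule cong_modulus_mult_nat)
      then have "even (k * t)" by (metis cong_def dvd_add_left_iff dvd_imp_mod_0 dvd_triv_left even_iff_mod_2_eq_zero)
      then show False using k t by simp
    qed
    show "(\<exists>i. x \<in> A i) \<or> (\<exists>i. \<ominus> x \<in> A i)" if x: "x \<in> carrier R - {\<zero>}" for x
    proof -
      obtain a :: nat where a: "x = g [^] a" using gen[OF x] by blast
      show ?thesis
      proof (cases "even a")
        case True
        then obtain b where "a = 2 * b" by (elim evenE)
        then have "x \<in> A b" unfolding A_def a by auto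
        then show ?thesis by blast
      next
        case False
        then have "even (k * t + a)" using k t by simp
        then obtain b where "k * t + a = 2 * b" by (elim evenE)
        then have "\<ominus> x \<in> A b" unfolding A_def a neg by auto
        then show ?thesis by blast
      qed
    qed
  qed
  then show ?thesis by blast
qed

text \<open>By AM-GM, \<open>2 w a \<le> a\<^sup>2 + w\<^sup>2\<close> removes the square root from the
  error term; the weights \<open>w = 40\<close> and \<open>w = 5 k\<^sup>2\<close> approximate \<open>sqrt (q - t)\<close>.\<close>

lemma solutions_exceed_exclusions:
  fixes k t n m M N :: nat
  assumes k: "k = 3 \<or> k \<ge> 5" and m: "k = Suc (Suc m)" and n: "n \<ge> 1" and M: "M + k = n * k"
    and q: "8 * k ^ 5 * n < 2 * k * t + 1"
    and N: "((real t)\<^sup>2 / real (2 * k * t + 1) - real N)\<^sup>2 \<le> real (2 * k * t + 1) - real t"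
  shows "2 * (m * (M + m)) + 4 * (m * m) + (M + m) + 4 * m < N"
proof (rule ccontr)
  let ?D = "2 * (m * (M + m)) + 4 * (m * m) + (M + m) + 4 * m"
  assume "\<not> ?D < N"
  then have "N \<le> ?D" by simp
  then have ND: "real N \<le> real ?D" by (rule of_nat_mono)
  define K T Q n' where "K = real k" and "T = real t" and "Q = real (2 * k * t + 1)" and "n' = real n"
  have K3: "K \<ge> 3" using k unfolding K_def by auto
  have n1: "n' \<ge> 1" using n unfolding n'_def by simp
  have QT: "Q = 2 * K * T + 1" unfolding Q_def K_def T_def by simp
  have T0: "T \<ge> 0" unfolding T_def by simp
  have Q0: "Q > 0" unfolding QT using K3 T0 by (simp add: add_nonneg_pos)
  have mK: "real m = K - 2" unfolding K_def m by simp
  have "real M + K = n' * K" unfolding K_def n'_def using M by (metis of_nat_add of_nat_mult)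
  then have MK: "real M = (n' - 1) * K" by (simp add: algebra_simps)
  define D where "D = real ?D"
  have D: "D = (n' - 1) * K * (2 * K - 3) + 6 * (K - 2)\<^sup>2 + 5 * (K - 2)"
    unfolding D_def by (simp add: mK MK algebra_simps power2_eq_square)
  have Qbig: "8 * K ^ 5 * n' < Q"
  proof -
    have "real (8 * k ^ 5 * n) < real (2 * k * t + 1)" using q by (simp only: of_nat_less_iff)
    then show ?thesis unfolding Q_def K_def n'_def by simp
  qed
  have main: "2 * w * ((Q - 2) / (4 * K\<^sup>2) - D) \<le> Q - T + w\<^sup>2" if w: "w \<ge> 0" for w
  proof -
    define a where "a = T\<^sup>2 / Q - real N"
    have "0 \<le> (a - w)\<^sup>2" by simp
    then have "2 * w * a \<le> a\<^sup>2 + w\<^sup>2" by (simp add: power2_diff algebra_simps)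
    moreover have "a\<^sup>2 \<le> Q - T" using N unfolding a_def Q_def T_def .
    \<comment> \<open>Since 2 K T = Q - 1, this is Q (Q - 2) \<le> (Q - 1)^2; it makes the main term
      linear in \<open>Q\<close>.\<close>
    moreover have "(Q - 2) / (4 * K\<^sup>2) \<le> T\<^sup>2 / Q"
    proof -
      have "(Q - 2) * Q \<le> (Q - 1)\<^sup>2" by (simp add: power2_eq_square algebra_simps)
      also have "\<dots> = T\<^sup>2 * (4 * K\<^sup>2)" unfolding QT by (simp add: power2_eq_square)
      finally show ?thesis using Q0 K3 by (simp add: field_simps)
    qed
    then have "2 * w * ((Q - 2) / (4 * K\<^sup>2) - D) \<le> 2 * w * a"
      using w ND unfolding a_def D_def by (intro mult_left_mono) auto
    ultimately show ?thesis by linarith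
  qed
  \<comment> \<open>With the weight \<open>5 * K\<^sup>2\<close> the argument ends in a polynomial
    that is negative at K = 3, so that case gets its own weight. There Q > 1944 and Q - T is about 5
    Q / 6, whose root at Q = 1944 is close to 40.\<close>
  show False
  proof (cases "k = 3")
    case True
    then have K: "K = 3" unfolding K_def by simp
    have "T = (Q - 1) / 6" unfolding QT K by simp
    moreover have "D = 9 * n' + 2" unfolding D K by (simp add: algebra_simps)
    moreover have "1944 * n' < Q" using Qbig unfolding K by simp
    moreover have "80 * ((Q - 2) / 36 - D) \<le> Q - T + 1600" using main[of 40] unfolding K by simp
    ultimately show False using n1 by (simp add: field_simps)
  next
    case False
    then have K5: "K \<ge> 5" using k unfolding K_def by simp
    \<comment> \<open>A weight proportional to K^2 makes the coefficient of \<open>Q\<close> the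
      constant 5/2. After subtracting the \<open>Q\<close> on the right, 3/2 of \<open>Q\<close>
      remains, hence 12 K^5 n'.\<close>
    have "10 * K\<^sup>2 * ((Q - 2) / (4 * K\<^sup>2) - D) = 5 / 2 * (Q - 2) - 10 * K\<^sup>2 * D"
      using K5 by (simp add: field_simps)
    then have "5 / 2 * (Q - 2) - 10 * K\<^sup>2 * D \<le> Q - T + (5 * K\<^sup>2)\<^sup>2" using main[of "5 * K\<^sup>2"] by simp
    moreover have "(5 * K\<^sup>2)\<^sup>2 = 25 * K ^ 4" by (simp add: power_mult_distrib)
    ultimately have 1: "12 * K ^ 5 * n' < 10 * K\<^sup>2 * D + 25 * K ^ 4 + 5"
      using Qbig T0 by argo
    have "D \<le> 2 * K\<^sup>2 * n' + 4 * K\<^sup>2 - 19 * K + 14"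
    proof -
      have "0 \<le> 3 * K * (n' - 1)" using K5 n1 by simp
      then show ?thesis unfolding D by (simp add: algebra_simps power2_eq_square)
    qed
    then have "10 * K\<^sup>2 * D \<le> 10 * K\<^sup>2 * (2 * K\<^sup>2 * n' + 4 * K\<^sup>2 - 19 * K + 14)"
      by (intro mult_left_mono) auto
    also have "\<dots> = 20 * K ^ 4 * n' + 40 * K ^ 4 - 190 * K ^ 3 + 140 * K\<^sup>2"
      by (simp add: algebra_simps power2_eq_square power3_eq_cube power4_eq_xxxx)
    finally have 2: "(12 * K ^ 5 - 20 * K ^ 4) * n' < 65 * K ^ 4 - 190 * K ^ 3 + 140 * K\<^sup>2 + 5"
      using 1 by (simp add: algebra_simps)
    have pos: "0 \<le> 12 * K ^ 5 - 20 * K ^ 4"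
    proof -
      have "12 * K ^ 5 - 20 * K ^ 4 = K ^ 4 * (12 * K - 20)" by (simp add: algebra_simps eval_nat_numeral)
      then show ?thesis using K5 by simp
    qed
    \<comment> \<open>As the coefficient of \<open>n'\<close> is nonnegative, n' = 1 is the worst
      case, and only a polynomial in \<open>K\<close> is left.\<close>
    then have "12 * K ^ 5 - 20 * K ^ 4 \<le> (12 * K ^ 5 - 20 * K ^ 4) * n'"
      using n1 by (simp add: mult_le_cancel_left1)
    then have 3: "12 * K ^ 5 - 85 * K ^ 4 + 190 * K ^ 3 - 140 * K\<^sup>2 < 5" using 2 by simp
    \<comment> \<open>The cubic factor is expanded around K = 5, where its value is 185; all other
      terms are nonnegative for K \<ge> 5.\<close>
    have "12 * K ^ 5 - 85 * K ^ 4 + 190 * K ^ 3 - 140 * K\<^sup>2 =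
        K\<^sup>2 * ((K - 5) * (12 * K * (K - 5) + 35 * K + 65) + 185)"
      by (simp add: algebra_simps eval_nat_numeral)
    moreover have "5\<^sup>2 * 185 \<le> K\<^sup>2 * ((K - 5) * (12 * K * (K - 5) + 35 * K + 65) + 185)"
      using K5 by (intro mult_mono power_mono) auto
    ultimately show False using 3 by simp
  qed
qed

theorem theorem1p14:
  fixes k r q :: nat
  assumes "odd k" and "k \<ge> 3" and "r \<ge> 1"
    and "\<exists>p n. prime p \<and> n \<ge> 1 \<and> q = p ^ n"
    and "[q = 2 * k + 1] (mod 4 * k)"
    and "int q > 8 * int k ^ 5 * \<lceil>real r / real k\<rceil>"
  shows "MOHS ((q - 1) div 2) k r"
proof -
  obtain p e where p: "prime p" "e \<ge> 1" "q = p ^ e" using assms(4) by blast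
  obtain F :: "((int list \<times> nat) multiset \<Rightarrow> int) ring"
    where F: "field F" "finite (carrier F)" "card (carrier F) = q"
    using exists_finite_field[OF p(1,2)] p(3) by metis
  define s where "s = q div (4 * k)"
  define t where "t = 2 * s + 1"
  have "q mod (4 * k) = 2 * k + 1" using assms(2,5) by (simp add: cong_def)
  then have "q = 4 * k * s + (2 * k + 1)" unfolding s_def by (metis mult_div_mod_eq)
  then have q: "q = 2 * k * t + 1" unfolding t_def by (simp add: algebra_simps)
  have todd: "odd t" unfolding t_def by simp
  interpret F: field F by (rule F(1))
  obtain A where "cyclotomic_classes F k t A"
    using F.exists_cyclotomic_classes[of k t] F assms(1,2) todd q by auto
  then interpret cyclotomic_classes F k t A .
  define n where "n = nat \<lceil>real r / real k\<rceil>"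
  have "real r / real k > 0" using assms by simp
  then have c1: "\<lceil>real r / real k\<rceil> \<ge> 1" by simp
  have nc: "int n = \<lceil>real r / real k\<rceil>" unfolding n_def using c1 by (intro int_nat_eq[THEN trans]) auto
  then have n1: "n \<ge> 1" using c1 by linarith
  have "real r / real k \<le> real n" using nc by linarith
  then have "real r \<le> real (n * k)" using assms(2) by (simp add: field_simps)
  then have r: "r \<le> n * k" by (simp only: of_nat_le_iff)
  have qbig: "8 * k ^ 5 * n < 2 * k * t + 1"
  proof -
    have "int (8 * k ^ 5 * n) < int q" using assms(6) nc by simp
    then show ?thesis unfolding q by (simp only: of_nat_less_iff)
  qed
  obtain m where m: "k = Suc (Suc m)" by (rule that[of "k - 2"]) (use assms(2) in simp)
  define M where "M = (n - 1) * k"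
  have M: "M + k = n * k" unfolding M_def using n1 by (cases n) auto
  have k35: "k = 3 \<or> k \<ge> 5" using assms(1,2) by presburger
  \<comment> \<open>The greedy part needs only about k^2 n values, while the assumption on
    \<open>q\<close> gives t \<ge> 4 k^4 n, which is at least 36 k^2 n.\<close>
  have tbig: "k * (M + k) + k * k + 1 < t"
  proof -
    have "2 * k * (4 * k ^ 4 * n) \<le> 2 * k * t" using qbig by (simp add: eval_nat_numeral algebra_simps)
    then have "4 * k ^ 4 * n \<le> t" using assms(2) by (simp add: mult_ac)
    moreover have "k * k * n * (4 * 9) \<le> k * k * n * (4 * (k * k))"
      using mult_mono[OF assms(2) assms(2)] by (intro mult_left_mono) auto
    moreover have "k * k * n * (4 * (k * k)) = 4 * k ^ 4 * n" by (simp add: eval_nat_numeral algebra_simps)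
    moreover have "k * k * 1 \<le> k * k * n" using n1 by (intro mult_left_mono) auto
    moreover have "3 * 3 \<le> k * k" using assms(2) by (intro mult_mono) auto
    moreover have "k * (M + k) = k * k * n" unfolding M by (simp add: algebra_simps)
    ultimately show ?thesis by linarith
  qed
  obtain b where "block_family n b"
    using block_family_exists[OF m M tbig solutions_exceed_exclusions[OF k35 m n1 M qbig]] by blast
  then have "MOHS (k * t) k r" using r by (rule MOHS_of_block_family)
  moreover have "(q - 1) div 2 = k * t" unfolding q by simp
  ultimately show ?thesis by simp
qed

end
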